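(* Let $X$ be a symmetric log-concave real random variable and let $\alpha>0$, $\alpha\neq 1$. Let $\alpha^*$ be the unique solution (in $(0,\infty)\setminus\{1\}$) of the equation $\frac{1}{\alpha-1}\log\alpha=\frac12\log 6$ (so $\alpha^*\approx 1.241$). Then \[ h_\alpha(X)\ \geq\ \tfrac12\log \mathrm{Var}(X)+\tfrac12\log 12 \qquad\text{if } \alpha\leq\alpha^*, \] and \[ h_\alpha(X)\ \geq\ \tfrac12\log \mathrm{Var}(X)+\tfrac12\log 2+\frac{\log\alpha}{\alpha-1}\qquad\text{if } \alpha\geq\alpha^*. \] Moreover: for $\alpha<\alpha^*$ equality holds if and only if $X$ is uniformly distributed on a symmetric interval; for $\alpha>\alpha^*$ equality holds if and only if $X$ has a two-sided exponential distribution; and for $\alpha=\alpha^*$ equality holds if and only if $X$ is either uniformly distributed on a symmetric interval or has a two-sided exponential distribution.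
   Context: A real random variable $X$ is log-concave if it has a density (with respect to Lebesgue measure) of the form $f=e^{-V}$ with $V:\mathbb{R}\to(-\infty,\infty]$ convex. It is symmetric if $X$ and $-X$ have the same distribution (equivalently, for log-concave $X$, the density may be taken even). For a random variable $X$ with density $f$ and $\alpha\in(0,\infty)\setminus\{1\}$, the Rényi entropy of order $\alpha$ is $h_\alpha(X)=\frac{1}{1-\alpha}\log\left(\int f^\alpha(x)\,\mathrm{d}x\right)$. A symmetric interval is one of the form $[-L,L]$ with $L>0$ (up to endpoints). A two-sided exponential distribution is one with density $\frac{\lambda}{2}e^{-\lambda|x|}$, $x\in\mathbb{R}$, for some $\lambda>0$. $\log$ is the natural logarithm. *)

theory Defs
  imports "HOL-Probability.Probability"
begin

text \<open>
  Convexity of an extended-real valued function on the line. On the degenerate weights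
  the convention \<open>0 * \<infinity> = 0\<close> makes the inequality trivial, and for functions avoiding
  \<open>-\<infinity>\<close> the right-hand side never has the form \<open>\<infinity> - \<infinity>\<close>.
\<close>

definition convex_ereal :: "(real \<Rightarrow> ereal) \<Rightarrow> bool" where
  "convex_ereal V \<longleftrightarrow>
     (\<forall>x y u v. 0 \<le> u \<longrightarrow> 0 \<le> v \<longrightarrow> u + v = 1 \<longrightarrow>
        V (u * x + v * y) \<le> ereal u * V x + ereal v * V y)"

text \<open>\<open>e\<^sup>-\<^sup>v\<close> for \<open>v \<in> (-\<infinity>, \<infinity>]\<close>; the value at \<open>-\<infinity>\<close> is irrelevant.\<close>

definition exp_neg_ereal :: "ereal \<Rightarrow> ennreal" where
  "exp_neg_ereal v = (if v = \<infinity> then 0 else ennreal (exp (- real_of_ereal v)))"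

definition log_concave_rv :: "'a measure \<Rightarrow> ('a \<Rightarrow> real) \<Rightarrow> bool" where
  "log_concave_rv M X \<longleftrightarrow>
     (\<exists>V. (\<forall>x. V x \<noteq> -\<infinity>) \<and> convex_ereal V \<and>
          distributed M lborel X (\<lambda>x. exp_neg_ereal (V x)))"

definition symmetric_rv :: "'a measure \<Rightarrow> ('a \<Rightarrow> real) \<Rightarrow> bool" where
  "symmetric_rv M X \<longleftrightarrow> distr M lborel X = distr M lborel (\<lambda>\<omega>. - X \<omega>)"

text \<open>
  The density of \<open>X\<close> is taken to be the Radon--Nikodym derivative of its law; by
  \<open>renyi_entropy_eq_density\<close> below any other density gives the same value. The integral
  is the Bochner integral, so the value is only meaningful when \<open>f\<^sup>\<alpha>\<close> is integrable,
  as it is for every log-concave density and every \<open>\<alpha> > 0\<close>.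
\<close>

definition renyi_entropy :: "real \<Rightarrow> 'a measure \<Rightarrow> ('a \<Rightarrow> real) \<Rightarrow> real" where
  "renyi_entropy \<alpha> M X =
     1 / (1 - \<alpha>) *
       ln (LINT x|lborel. enn2real (RN_deriv lborel (distr M lborel X) x) powr \<alpha>)"

lemma renyi_entropy_eq_density:
  assumes "distributed M lborel X f"
  shows "renyi_entropy \<alpha> M X = 1 / (1 - \<alpha>) * ln (LINT x|lborel. enn2real (f x) powr \<alpha>)"
proof -
  have f [measurable]: "f \<in> borel_measurable lborel" and d: "density lborel f = distr M lborel X"
    using assms by (auto simp: distributed_def)
  have "AE x in lborel. f x = RN_deriv lborel (distr M lborel X) x"
    using f d by (rule sigma_finite_measure.RN_deriv_unique[OF sigma_finite_lborel])
  then have "(LINT x|lborel. enn2real (RN_deriv lborel (distr M lborel X) x) powr \<alpha>) =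
      (LINT x|lborel. enn2real (f x) powr \<alpha>)"
    by (intro integral_cong_AE) auto
  then show ?thesis
    by (simp add: renyi_entropy_def)
qed

definition uniform_symmetric_rv :: "'a measure \<Rightarrow> ('a \<Rightarrow> real) \<Rightarrow> bool" where
  "uniform_symmetric_rv M X \<longleftrightarrow> (\<exists>L>0. distr M lborel X = uniform_measure lborel {-L..L})"

definition two_sided_exponential_rv :: "'a measure \<Rightarrow> ('a \<Rightarrow> real) \<Rightarrow> bool" where
  "two_sided_exponential_rv M X \<longleftrightarrow>
     (\<exists>l>0. distributed M lborel X (\<lambda>x. ennreal (l / 2 * exp (- l * \<bar>x\<bar>))))"

definition is_critical_order :: "real \<Rightarrow> bool" where
  "is_critical_order a \<longleftrightarrow> 0 < a \<and> a \<noteq> 1 \<and> 1 / (a - 1) * ln a = 1 / 2 * ln 6"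

definition alpha_star :: real where
  "alpha_star = (THE a. is_critical_order a)"

end

theory Submission
  imports Defs
begin

text \<open>
  The two minima of the entropy are compared at the critical order \<open>p = alpha_star\<close> only. For
  \<open>\<alpha> < p\<close> the first bound follows because \<open>h\<^sub>\<alpha>\<close> is nonincreasing in \<open>\<alpha>\<close>, and for
  \<open>\<alpha> > p\<close> the second one because \<open>h\<^sub>\<alpha> - ln \<alpha> / (\<alpha> - 1)\<close> is nondecreasing in \<open>\<alpha>\<close> on
  log-concave densities.

  At the critical order, let \<open>F\<close> be an even log-concave density and let \<open>x u\<close> be half the length of
  \<open>{F > F 0 e\<^sup>-\<^sup>u}\<close>, a concave nondecreasing function. With \<open>U\<close> a standard exponential variable,
  the layer cake formula gives \<open>\<integral>F\<^sup>q = 2 F(0)\<^sup>q E x(U/q)\<close> and \<open>\<integral>y\<^sup>2F = 2/3 F(0) E x(U)\<^sup>3\<close>.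
  Put \<open>A = E x(U)\<close>, \<open>C = E x(U/p)\<close>, \<open>B = E x(U)\<^sup>3\<close> and \<open>K = p/(p-1) (A - C)\<close>; the uniform law
  has \<open>K = 0\<close>, the two-sided exponential one \<open>K = A\<close>. The key inequality is
  \<open>B \<le> A\<^sup>3 + 3/2 A\<^sup>2K + 7/2 K\<^sup>3\<close>. Both sides are cubic forms in \<open>x\<close> and concave profiles are
  mixtures of the functions \<open>min u s\<close>, so by polarisation it is enough to compare the trilinear
  forms at triples of such functions. It then remains to bound \<open>1 + 3/2 r + 7/2 r\<^sup>3\<close> on \<open>[0,1]\<close>
  by \<open>(1 - (1 - 1/p) r)\<close> raised to the power \<open>- 2/(p-1)\<close>, with equality only at \<open>0\<close> and \<open>1\<close>.
\<close>

subsection \<open>The trilinear inequality\<close>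

text \<open>The trilinear inequality is tight at both ends: as all arguments tend to 0 (the uniform
  law) both sides behave like the product of the arguments, and as all tend to infinity (the
  exponential law) both tend to 6. Crude numerical bounds therefore fail, and small and large middle
  arguments get different proofs. As \<open>p\<close> is known only through its equation and a
  numerical bracket, the trilinear part treats a whole interval of orders; the equation for
  \<open>p\<close> is used only afterwards. Equality is never traced through polarisation or limits.
  At \<open>p\<close> it forces K = 0 or K = A, and these are the equality cases of two pointwise
  bounds, F^p \<le> F(0)^(p-1) F and x(u/p) \<ge> x(u)/p. At any other order, equality forces
  equality at \<open>p\<close>, and the strict decrease of ln a / (a - 1) rules out the wrong law.
  Both monotonicities compare chords starting at order 1, where \<integral>F^q = 1: log
  \<integral>F^q is convex by Hoelder, while log (q \<integral>F^q) is concave because q E x(U/q) is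
  concave in q.\<close>

lemma sum_le_exp:
  fixes x :: real
  assumes "0 \<le> x"
  shows "(\<Sum>i<n. x ^ i / fact i) \<le> exp x"
proof -
  have s: "(\<lambda>i. x ^ i / fact i) sums exp x"
    using exp_converges[of x] by (simp add: scaleR_conv_of_real divide_inverse mult.commute)
  show ?thesis
    using sum_le_suminf[OF sums_summable[OF s], of "{..<n}"] assms s
    by (simp add: sums_iff)
qed

lemma nonneg_from_deriv:
  fixes f g :: "real \<Rightarrow> real"
  assumes "\<And>t. (f has_real_derivative g t) (at t)" and "0 \<le> f 0"
    and "\<And>t. 0 \<le> t \<Longrightarrow> 0 \<le> g t" and "0 \<le> x"
  shows "0 \<le> f x"
proof -
  have "f 0 \<le> f x"
    using assms by (intro DERIV_nonneg_imp_nondecreasing[of 0 x f]) blast+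
  with assms show ?thesis by simp
qed

text \<open>Each bound is integrated from 0 to give the next one, starting from exp (- t) \<ge> 1 -
  t.\<close>

lemma exp_minus_bounds:
  fixes x :: real
  assumes "0 \<le> x"
  shows "exp (- x) \<le> 1 - x + x^2/2 - x^3/6 + x^4/24"
    and "1 - x + x^2/2 - x^3/6 \<le> exp (- x)"
proof -
  have 1: "0 \<le> exp (- t) - (1 - t)" for t :: real
    using exp_ge_add_one_self[of "-t"] by simp
  have d2: "((\<lambda>t. 1 - t + t^2/2 - exp (- t)) has_real_derivative exp (- t) - (1 - t)) (at t)" for t :: real
    by (rule derivative_eq_intros refl | simp)+
  have 2: "0 \<le> 1 - t + t^2/2 - exp (- t)" if "0 \<le> t" for t :: real
    using nonneg_from_deriv[OF d2 _ 1 that] by simp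
  have d3: "((\<lambda>t. exp (- t) - (1 - t + t^2/2 - t^3/6)) has_real_derivative 1 - t + t^2/2 - exp (- t)) (at t)" for t :: real
    by (rule derivative_eq_intros refl | simp)+
  have 3: "0 \<le> exp (- t) - (1 - t + t^2/2 - t^3/6)" if "0 \<le> t" for t :: real
    using nonneg_from_deriv[OF d3 _ 2 that] by simp
  have d4: "((\<lambda>t. 1 - t + t^2/2 - t^3/6 + t^4/24 - exp (- t)) has_real_derivative
      exp (- t) - (1 - t + t^2/2 - t^3/6)) (at t)" for t :: real
    by (rule derivative_eq_intros refl | simp)+
  have 4: "0 \<le> 1 - t + t^2/2 - t^3/6 + t^4/24 - exp (- t)" if "0 \<le> t" for t :: real
    using nonneg_from_deriv[OF d4 _ 3 that] by simp
  show "exp (- x) \<le> 1 - x + x^2/2 - x^3/6 + x^4/24" "1 - x + x^2/2 - x^3/6 \<le> exp (- x)"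
    using 3[OF assms] 4[OF assms] by simp_all
qed

text \<open>
  For a standard exponential variable \<open>U\<close>: \<open>mean_min s = E (min U s)\<close>, \<open>gap_min p s\<close> is
  \<open>p/(p-1)\<close> times \<open>E (min U s) - E (min (U/p) s)\<close> and has derivative \<open>e\<^sup>-\<^sup>s gap_rate p s\<close>, and
  \<open>moment3_min r s t = E (min U r * min U s * min U t)\<close> provided that \<open>r \<le> s \<le> t\<close>.
  \<open>cubic_form\<close> is the polarisation of \<open>A\<^sup>3 + 3/2 A\<^sup>2K + 7/2 K\<^sup>3\<close>. The equality cases force the
  value \<open>1\<close> at \<open>K = 0\<close> and the value \<open>6\<close> and slope \<open>12\<close> in \<open>K\<close> at \<open>A = K = 1\<close>; dropping the
  \<open>A K\<^sup>2\<close> term is the remaining, free choice.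
  Up to positive factors, \<open>balance p r s\<close> is the derivative of \<open>cubic_form - moment3_min\<close> when
  the larger arguments are moved.
\<close>

definition mean_min :: "real \<Rightarrow> real" where "mean_min s = 1 - exp (- s)"
definition gap_min :: "real \<Rightarrow> real \<Rightarrow> real" where
  "gap_min p s = 1 - exp (- s) - (exp (- s) - exp (- (p * s))) / (p - 1)"
definition gap_rate :: "real \<Rightarrow> real \<Rightarrow> real" where
  "gap_rate p s = p / (p - 1) * (1 - exp (- ((p - 1) * s)))"
definition moment3_min :: "real \<Rightarrow> real \<Rightarrow> real \<Rightarrow> real" where
  "moment3_min r s t = 6 - (r\<^sup>2 + 4 * r + 6) * exp (- r) - r * (s + 2) * exp (- s) - r * s * exp (- t)"
definition cubic_form :: "real \<Rightarrow> real \<Rightarrow> real \<Rightarrow> real \<Rightarrow> real \<Rightarrow> real \<Rightarrow> real" where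
  "cubic_form a k b l c m = a * b * c + (a * b * m + a * l * c + k * b * c) / 2 + 7/2 * k * l * m"
definition balance :: "real \<Rightarrow> real \<Rightarrow> real \<Rightarrow> real" where
  "balance p r s = mean_min r * mean_min s + (mean_min r * gap_min p s + gap_min p r * mean_min s) / 2
     + (mean_min r * mean_min s / 2 + 7/2 * gap_min p r * gap_min p s) * gap_rate p s - r * s"

lemma mean_min_deriv: "(mean_min has_real_derivative exp (- s)) (at s)"
  unfolding mean_min_def[abs_def] by (auto intro!: derivative_eq_intros)

lemma gap_min_deriv:
  assumes "p \<noteq> 1"
  shows "(gap_min p has_real_derivative exp (- s) * gap_rate p s) (at s)"
proof -
  have e: "exp (- (p * s)) = exp (- s) * exp (- ((p - 1) * s))"
    unfolding exp_add[symmetric] by (simp add: left_diff_distrib)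
  have "(gap_min p has_real_derivative (exp (- s) - (- exp (- s) + p * exp (- (p * s))) / (p - 1))) (at s)"
    unfolding gap_min_def[abs_def] using assms by (auto intro!: derivative_eq_intros)
  also have "exp (- s) - (- exp (- s) + p * exp (- (p * s))) / (p - 1) = exp (- s) * gap_rate p s"
    unfolding e gap_rate_def using assms by (simp add: divide_simps) algebra
  finally show ?thesis .
qed

lemma mean_min_nonneg: "0 \<le> s \<Longrightarrow> 0 \<le> mean_min s"
  by (auto simp: mean_min_def)

lemma gap_rate_mono: "1 < p \<Longrightarrow> s \<le> t \<Longrightarrow> gap_rate p s \<le> gap_rate p t"
  unfolding gap_rate_def by (intro mult_left_mono) auto

lemma gap_min_nonneg: assumes "1 < p" "0 \<le> s" shows "0 \<le> gap_min p s"
proof (rule nonneg_from_deriv[where f = "gap_min p" and g = "\<lambda>t. exp (- t) * gap_rate p t" and x = s])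
  show "(gap_min p has_real_derivative exp (- t) * gap_rate p t) (at t)" for t
    using assms by (intro gap_min_deriv) simp
  show "0 \<le> exp (- t) * gap_rate p t" if "0 \<le> t" for t
    using assms gap_rate_mono[of p 0 t] that by (simp add: gap_rate_def)
qed (use assms in \<open>simp_all add: gap_min_def\<close>)

text \<open>The polynomial is the Taylor polynomial of s / (1 - exp (- s)) at 0, with an error of
  order s^4. Cleared of denominators, the claim is the Pade bound exp s * (12 - 6 s + s^2) \<ge> 12
  + 6 s + s^2; three differentiations of the difference leave t^2 exp t.\<close>

lemma mean_min_pade:
  assumes "0 \<le> s"
  shows "s \<le> (1 + s/2 + s^2/12) * mean_min s"
proof -
  have d1: "((\<lambda>t. exp t * (2 - 2 * t + t^2) - 2) has_real_derivative exp t * t^2) (at t)" for t :: real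
    by (rule derivative_eq_intros refl | simp add: algebra_simps)+
  have 1: "0 \<le> exp t * (2 - 2 * t + t^2) - 2" if "0 \<le> t" for t :: real
    using nonneg_from_deriv[OF d1 _ _ that] by simp
  have d2: "((\<lambda>t. exp t * (6 - 4 * t + t^2) - 6 - 2 * t) has_real_derivative
      exp t * (2 - 2 * t + t^2) - 2) (at t)" for t :: real
    by (rule derivative_eq_intros refl | simp add: algebra_simps)+
  have 2: "0 \<le> exp t * (6 - 4 * t + t^2) - 6 - 2 * t" if "0 \<le> t" for t :: real
    using nonneg_from_deriv[OF d2 _ 1 that] by simp
  have d3: "((\<lambda>t. exp t * (12 - 6 * t + t^2) - (12 + 6 * t + t^2)) has_real_derivative
      exp t * (6 - 4 * t + t^2) - 6 - 2 * t) (at t)" for t :: real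
    by (rule derivative_eq_intros refl | simp add: algebra_simps)+
  have 3: "0 \<le> exp s * (12 - 6 * s + s^2) - (12 + 6 * s + s^2)"
    using nonneg_from_deriv[OF d3 _ 2 assms] by simp
  then have "0 \<le> exp (- s) * (exp s * (12 - 6 * s + s^2) - (12 + 6 * s + s^2))" by simp
  also have "\<dots> = (12 - 6 * s + s^2) - exp (- s) * (12 + 6 * s + s^2)"
    by (simp add: exp_minus field_simps)
  also have "\<dots> = 12 * ((1 + s/2 + s^2/12) * mean_min s - s)"
    unfolding mean_min_def by (simp add: field_simps)
  finally show ?thesis by simp
qed

text \<open>
  With \<open>d = s - 2\<close> and \<open>exp s\<close> replaced by \<open>7.38 (1 + d + d\<^sup>2/2)\<close>, all three expressions become
  polynomials in \<open>d\<close> with positive coefficients.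
\<close>

lemma exp_quadratics_nonneg:
  fixes s :: real
  assumes "2 \<le> s"
  defines "z \<equiv> exp s" and "q \<equiv> 6 + 8 * s + 7/2 * s^2"
  shows "0 \<le> z^2 - z * (4 + 3 * s + s^2/3) + q * (3 + s) / 6"
    and "0 \<le> z^2 - z * (4 + 3 * s + s^2/2) + q * (3 + s) / 6 + s^2 * q / 24"
    and "2 + 9/2 * s + 7/2 * s^2 \<le> 34/10 * z"
proof -
  define d where "d = s - 2"
  have s: "s = 2 + d" and d: "0 \<le> d" using assms by (simp_all add: d_def)
  define w where "w = 369/50 * (1 + d + d^2/2)"
  have "w \<le> exp 2 * exp d"
    unfolding w_def using exp_lower_Taylor_quadratic[OF d] sum_le_exp[of 2 9] d
    by (intro mult_mono) (auto simp: eval_nat_numeral)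
  then have wz: "w \<le> z" by (simp add: z_def s exp_add)
  \<comment> \<open>Beyond B/2 the quadratic increases in z, so z may be lowered to w once B \<le> 2
    w.\<close>
  have quad: "0 \<le> z^2 - z * B + C" if "0 \<le> w^2 - w * B + C" "B \<le> 2 * w" for B C
  proof -
    have "0 \<le> (z - w) * (z + w - B)" using that wz by (intro mult_nonneg_nonneg) auto
    then show ?thesis using that by (simp add: power2_eq_square algebra_simps)
  qed
  show "0 \<le> z^2 - z * (4 + 3 * s + s^2/3) + q * (3 + s) / 6"
  proof (rule quad[of _ "q * (3 + s) / 6"])
    have "0 \<le> 2061/2500 + 33079/1875 * d + 294391/7500 * d^2 + 274483/7500 * d^3 + 123861/10000 * d^4"
      using d by (intro add_nonneg_nonneg mult_nonneg_nonneg) simp_all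
    also have "\<dots> = w^2 - w * (4 + 3 * s + s^2/3) + q * (3 + s) / 6"
      unfolding w_def q_def s by (simp add: power_numeral_reduce field_simps)
    finally show "0 \<le> w^2 - w * (4 + 3 * s + s^2/3) + q * (3 + s) / 6" .
    show "4 + 3 * s + s^2/3 \<le> 2 * w"
      unfolding w_def s using d by (simp add: power2_eq_square field_simps)
  qed
  have "0 \<le> z^2 - z * (4 + 3 * s + s^2/2) + (q * (3 + s) / 6 + s^2 * q / 24)"
  proof (rule quad)
    have "0 \<le> 4761/2500 + 10918/625 * d + 272941/7500 * d^2 + 129029/3750 * d^3 + 89377/7500 * d^4"
      using d by (intro add_nonneg_nonneg mult_nonneg_nonneg) simp_all
    also have "\<dots> = w^2 - w * (4 + 3 * s + s^2/2) + (q * (3 + s) / 6 + s^2 * q / 24)"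
      unfolding w_def q_def s by (simp add: power_numeral_reduce field_simps)
    finally show "0 \<le> w^2 - w * (4 + 3 * s + s^2/2) + (q * (3 + s) / 6 + s^2 * q / 24)" .
    show "4 + 3 * s + s^2/2 \<le> 2 * w"
      unfolding w_def s using d by (simp add: power2_eq_square field_simps)
  qed
  then show "0 \<le> z^2 - z * (4 + 3 * s + s^2/2) + q * (3 + s) / 6 + s^2 * q / 24" by simp
  have "0 \<le> 23/250 + 824/125 * d + 4523/500 * d^2"
    using d by (intro add_nonneg_nonneg mult_nonneg_nonneg) simp_all
  also have "\<dots> = 34/10 * w - (2 + 9/2 * s + 7/2 * s^2)"
    unfolding w_def s by (simp add: power_numeral_reduce field_simps)
  finally show "2 + 9/2 * s + 7/2 * s^2 \<le> 34/10 * z" using wz by simp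
qed

text \<open>Termwise, R is the sum of r^k / k! over k \<ge> 5, and r (R + r^4/24) is the sum of k
  r^k / k! over the same k. The proof avoids series by differentiating
  \<open>exp (- t) * f t\<close>.\<close>

lemma exp_remainder_bound:
  fixes r :: real
  assumes "0 \<le> r"
  defines "R \<equiv> exp r - (1 + r + r^2/2 + r^3/6 + r^4/24)"
  shows "0 \<le> R" and "5 * R \<le> r * (R + r^4/24)"
proof -
  have R: "0 \<le> exp t - (1 + t + t^2/2 + t^3/6 + t^4/24)" if "0 \<le> t" for t :: real
    using sum_le_exp[OF that, of 5] by (simp add: eval_nat_numeral)
  show "0 \<le> R" using R assms by (simp add: R_def)
  define f where "f t = t * (exp t - (1 + t + t^2/2 + t^3/6)) - 5 * (exp t - (1 + t + t^2/2 + t^3/6 + t^4/24))" for t :: real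
  have "((\<lambda>t. exp (- t) * f t) has_real_derivative
      exp (- t) * (exp t - (1 + t + t^2/2 + t^3/6 + t^4/24))) (at t)" for t
    unfolding f_def by (rule derivative_eq_intros refl | simp)+ (simp add: power_numeral_reduce field_simps)
  from nonneg_from_deriv[OF this _ _ assms(1)] R have "0 \<le> exp (- r) * f r"
    by (simp add: f_def)
  then have "0 \<le> f r" by (simp add: zero_le_mult_iff)
  then show "5 * R \<le> r * (R + r^4/24)" by (simp add: f_def R_def algebra_simps)
qed

text \<open>
  Multiplied by \<open>e\<^sup>r\<close>, the difference of the two sides is \<open>r\<^sup>2 + (4 - cK) r + n - (n - r \<mu>) e\<^sup>r\<close>.
  Since \<open>n \<le> 5 \<mu>\<close>, the exponential may be replaced by its Taylor polynomial of degree four. This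
  already works with the limit \<open>p \<rightarrow> 1\<close> of \<open>gap_min p\<close>.
\<close>

lemma moment3_min_le_cubic_form_large:
  assumes "0 \<le> r" "r \<le> s" "s \<le> t" "2 \<le> s"
  defines "k0 \<equiv> \<lambda>s. 1 - exp (- s) * (1 + s)"
  shows "moment3_min r s t \<le> cubic_form (mean_min r) (k0 r) (mean_min s) (k0 s) (mean_min t) (k0 t)"
proof -
  define e h where "e = exp (- s)" and "h = exp (- t)"
  define a k b l where "a = 1 - e" and "k = 1 - e * (1 + s)" and "b = 1 - h" and "l = 1 - h * (1 + t)"
  \<comment> \<open>\<open>cubic_form\<close> is linear in its first pair: \<open>cA\<close> and
    \<open>cK\<close> are the coefficients of \<open>mean_min r\<close> and \<open>k0 r\<close>.
    With exp r = 1 + r + r^2 X + R, the expression to be bounded splits into r (cA - 2 + \<mu>), r^2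
    (1 - n X + \<mu> Y) and a term with the remainder R; \<open>\<delta>\<close>, \<open>W\<close>
    and \<open>nR\<close> treat these three.\<close>
  define cA cK where "cA = a * b + (a * l + k * b) / 2" and "cK = a * b / 2 + 7/2 * k * l"
  define n \<mu> where "n = 6 - cA - cK" and "\<mu> = (s + 2) * e + s * h"
  define G H where "G = 2 * a + 4 * k" and "H = a / 2 + 7/2 * k"
  define X Y where "X = 1/2 + r/6 + r^2/24" and "Y = 1 + r/2 + r^2/6"
  define q where "q = 6 + 8 * s + 7/2 * s^2"
  note abk = a_def b_def k_def l_def
  have e: "0 < e" "0 < h" by (simp_all add: e_def h_def)
  have hX: "h * (1 + (t - s)) \<le> e"
  proof -
    have "h * (1 + (t - s)) \<le> h * exp (t - s)" using e by simp
    also have "\<dots> = e" by (simp add: h_def e_def flip: exp_add)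
    finally show ?thesis .
  qed
  have he: "h \<le> e" using assms by (simp add: e_def h_def)
  have k0: "0 \<le> 1 - exp (- x) * (1 + x)" for x :: real
    using exp_ge_add_one_self[of x] by (simp add: exp_minus field_simps)
  have a: "0 \<le> a" "a \<le> 1" "0 \<le> b" "b \<le> 1" "0 \<le> k" "k \<le> 1" "0 \<le> l" "l \<le> 1"
    using assms e k0[of s] k0[of t] by (auto simp: abk e_def h_def)
  have cK: "cK \<le> 4"
  proof -
    have "a * b \<le> 1" "k * l \<le> 1" using a by (auto intro!: mult_le_one)
    then show ?thesis by (simp add: cK_def mult.assoc)
  qed
  have \<delta>: "0 \<le> cA - 2 + \<mu>"
  proof -
    have "a * t \<le> t" using a assms by (simp add: mult_left_le_one_le)
    then have "3/2 * a + k/2 + a * t / 2 - s \<le> 1 + (t - s)" using a \<open>2 \<le> s\<close> \<open>s \<le> t\<close> by linarith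
    then have "h * (3/2 * a + k/2 + a * t / 2 - s) \<le> h * (1 + (t - s))"
      using e by (intro mult_left_mono) auto
    also have "2 * e \<le> s * e" using \<open>2 \<le> s\<close> e by simp
    then have "h * (1 + (t - s)) \<le> s * e / 2" using hX by linarith
    also have "s * e / 2 = cA - 2 + \<mu> + h * (3/2 * a + k/2 + a * t / 2 - s)"
      by (simp add: cA_def \<mu>_def abk field_simps)
    finally show ?thesis by simp
  qed
  have n: "n = e * (6 + 4 * s) + h * (G + t * H)"
    by (simp add: n_def cA_def cK_def G_def H_def abk field_simps)
  have "h * (G + t * H) \<le> h * (6 + t * 4)"
    using a e assms by (intro mult_left_mono add_mono) (auto simp: G_def H_def)
  moreover have "h * (4 + 4 * (t - s)) \<le> 4 * e" using hX by (simp add: algebra_simps)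
  moreover have "0 \<le> s * e" "0 \<le> h * s" using assms e by auto
  moreover have "h * 2 \<le> h * s" using assms e by simp
  ultimately have n5: "n \<le> 5 * \<mu>" unfolding n \<mu>_def by (simp add: algebra_simps)
  have X0: "0 \<le> X" "0 \<le> H" using a assms by (auto simp: X_def H_def)
  have z: "exp s * e = 1" by (simp add: e_def exp_minus)
  have "(2 + 9/2 * s + 7/2 * s^2) * e \<le> 34/10 * exp s * e"
    using exp_quadratics_nonneg(3)[OF \<open>2 \<le> s\<close>] e by (intro mult_right_mono) auto
  then have e34: "e * (2 + 9/2 * s + 7/2 * s^2) \<le> 34/10" using z by (simp add: mult.commute)
  \<comment> \<open>With S the right-hand side, 1 - n X + \<mu> Y exceeds its value at t = s by e S
    - h (S + (t - s) H X). Since h (1 + (t - s)) \<le> e, the bound H X \<le> S makes this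
    nonnegative.\<close>
  have ZZ: "H * X \<le> G * X - s * Y + s * (H * X)"
  proof -
    have "G + (s - 1) * H = 4 * s + 2 - e * (2 + 9/2 * s + 7/2 * s^2)"
      by (simp add: G_def H_def abk power2_eq_square field_simps)
    then have "(4 * s - 14/10) * X \<le> (G + (s - 1) * H) * X"
      using e34 X0 by (intro mult_right_mono) auto
    moreover have "s * Y \<le> (4 * s - 14/10) * X"
    proof -
      have "r * r \<le> s * r" using assms by (intro mult_right_mono) auto
      moreover have "0 \<le> s * r" using assms by simp
      moreover have "s * (1 + r/6) - 14/10 * X = s + s * r / 6 - 7/10 - 7/30 * r - 7/120 * (r * r)"
        by (simp add: X_def power2_eq_square field_simps)
      ultimately have "0 \<le> s * (1 + r/6) - 14/10 * X"
        using \<open>2 \<le> s\<close> \<open>r \<le> s\<close> by linarith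
      also have "\<dots> = (4 * s - 14/10) * X - s * Y" by (simp add: X_def Y_def field_simps)
      finally show ?thesis by simp
    qed
    ultimately show ?thesis by (simp add: algebra_simps)
  qed
  have W: "0 \<le> 1 - n * X + \<mu> * Y"
  proof -
    \<comment> \<open>\<open>?n\<close> and \<open>?\<mu>\<close> are the values of \<open>n\<close>
      and \<open>\<mu>\<close> at t = s; - u/6 and - v/24 are then the coefficients of r and r^2. As
      no sign of \<open>v\<close> is known, the bound is checked at r = s both without the
      \<open>v\<close> term (\<open>W1\<close>) and with it (\<open>W2\<close>).\<close>
    define u v where "u = e * (6 + 2 * s) - e^2 * q" and "v = 4 * e - e^2 * q"
    let ?n = "e * (12 + 8 * s) - e^2 * q" and ?\<mu> = "(2 * s + 2) * e"
    have eq: "e^2 * exp s ^ 2 = 1" "e^2 * exp s = e"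
      using z by (simp_all add: power2_eq_square algebra_simps)
    have W1: "0 \<le> 1 - ?n/2 + ?\<mu> - s * u / 6"
    proof -
      have "0 \<le> e^2 * (exp s ^ 2 - exp s * (4 + 3 * s + s^2/3) + q * (3 + s) / 6)"
        using exp_quadratics_nonneg(1)[OF \<open>2 \<le> s\<close>] by (simp add: q_def)
      also have "\<dots> = e^2 * exp s ^ 2 - (e^2 * exp s) * (4 + 3 * s + s^2/3) + e^2 * q * (3 + s) / 6"
        by (simp add: field_simps)
      also have "\<dots> = 1 - ?n/2 + ?\<mu> - s * u / 6"
        unfolding eq u_def by (simp add: power2_eq_square field_simps)
      finally show ?thesis .
    qed
    have W2: "0 \<le> 1 - ?n/2 + ?\<mu> - s * u / 6 - s^2 * v / 24"
    proof -
      have "0 \<le> e^2 * (exp s ^ 2 - exp s * (4 + 3 * s + s^2/2) + q * (3 + s) / 6 + s^2 * q / 24)"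
        using exp_quadratics_nonneg(2)[OF \<open>2 \<le> s\<close>] by (simp add: q_def)
      also have "\<dots> = e^2 * exp s ^ 2 - (e^2 * exp s) * (4 + 3 * s + s^2/2) + e^2 * q * (3 + s) / 6 + e^2 * q * s^2 / 24"
        by (simp add: field_simps)
      also have "\<dots> = 1 - ?n/2 + ?\<mu> - s * u / 6 - s^2 * v / 24"
        unfolding eq u_def v_def by (simp add: power2_eq_square field_simps)
      finally show ?thesis .
    qed
    have u0: "0 \<le> u"
    proof -
      have "e * q = e * (2 + 9/2 * s + 7/2 * s^2) + e * (4 + 7/2 * s)" by (simp add: q_def algebra_simps)
      moreover have "e * (4 + 7/2 * s) \<le> e * (4 * (1 + s))" using e assms by (intro mult_left_mono) auto
      moreover have "e * (4 * (1 + s)) = 4 * (e * (1 + s))" by simp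
      moreover have "e * (1 + s) \<le> 1" using a by (simp add: k_def)
      ultimately have "e * q \<le> 6 + 2 * s" using e34 \<open>2 \<le> s\<close> by linarith
      then have "e * (e * q) \<le> e * (6 + 2 * s)" using e by (intro mult_left_mono) auto
      then show ?thesis by (simp add: u_def power2_eq_square algebra_simps)
    qed
    have "r * u \<le> s * u" using assms u0 by (intro mult_right_mono)
    moreover have "r^2 * v \<le> s^2 * v \<or> r^2 * v \<le> 0"
    proof (cases "0 \<le> v")
      case True
      then show ?thesis using assms by (intro disjI1 mult_right_mono power_mono) auto
    next
      case False
      then show ?thesis by (simp add: mult_nonneg_nonpos)
    qed
    ultimately have "0 \<le> 1 - ?n/2 + ?\<mu> - r * u / 6 - r^2 * v / 24"
      using W1 W2 by linarith
    also have "\<dots> = 1 - ?n * X + ?\<mu> * Y"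
      by (simp add: u_def v_def X_def Y_def field_simps)
    also have "\<dots> = 1 - n * X + \<mu> * Y - (e * (G * X - s * Y + s * (H * X)) - h * (G * X - s * Y + s * (H * X) + (t - s) * (H * X)))"
    proof -
      have nn: "?n = e * (6 + 4 * s) + e * (G + s * H)"
        by (simp add: G_def H_def abk q_def power2_eq_square field_simps)
      show ?thesis unfolding nn n \<mu>_def by (simp add: algebra_simps)
    qed
    also have "\<dots> \<le> 1 - n * X + \<mu> * Y"
    proof -
      let ?S = "G * X - s * Y + s * (H * X)"
      have S: "0 \<le> ?S" using ZZ X0 by (meson mult_nonneg_nonneg order.trans)
      have "?S + (t - s) * (H * X) \<le> ?S * (1 + (t - s))"
        using mult_left_mono[OF ZZ, of "t - s"] assms by (simp add: algebra_simps)
      then have "h * (?S + (t - s) * (H * X)) \<le> h * (?S * (1 + (t - s)))" using e by simp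
      also have "\<dots> = ?S * (h * (1 + (t - s)))" by simp
      also have "\<dots> \<le> ?S * e" using hX S by (intro mult_left_mono)
      finally show ?thesis by (simp add: mult.commute)
    qed
    finally show ?thesis .
  qed
  define R where "R = exp r - (1 + r + r^2/2 + r^3/6 + r^4/24)"
  have R: "0 \<le> R" "5 * R \<le> r * (R + r^4/24)"
    using exp_remainder_bound[OF \<open>0 \<le> r\<close>] by (simp_all add: R_def)
  have \<mu>0: "0 \<le> \<mu>" using assms e by (simp add: \<mu>_def)
  have "n * R \<le> 5 * \<mu> * R" using n5 R by (intro mult_right_mono)
  also have "\<dots> \<le> \<mu> * (r * (R + r^4/24))" using mult_left_mono[OF R(2) \<mu>0] by simp
  finally have nR: "n * R \<le> \<mu> * (r * (R + r^4/24))" .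
  have "0 \<le> r * (cA - 2 + \<mu>) + r^2 * (1 - n * X + \<mu> * Y)" using \<delta> W assms by simp
  also have "\<dots> \<le> r * (cA - 2 + \<mu>) + r^2 * (1 - n * X + \<mu> * Y) + (\<mu> * (r * (R + r^4/24)) - n * R)"
    using nR by simp
  also have "\<dots> = r^2 + (4 - cK) * r + n - (n - r * \<mu>) * exp r"
    unfolding R_def X_def Y_def n_def by (simp add: power_numeral_reduce field_simps)
  also have "\<dots> = exp r * (cubic_form (mean_min r) (k0 r) (mean_min s) (k0 s) (mean_min t) (k0 t) - moment3_min r s t)"
  proof -
    have st: "mean_min s = a" "k0 s = k" "mean_min t = b" "k0 t = l"
      by (simp_all add: mean_min_def k0_def abk e_def h_def)
    have r: "mean_min r = 1 - exp (- r)" "k0 r = 1 - exp (- r) * (1 + r)"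
      by (simp_all add: mean_min_def k0_def)
    have cubic_form: "cubic_form (mean_min r) (k0 r) (mean_min s) (k0 s) (mean_min t) (k0 t) = cA * (1 - exp (- r)) + cK * (1 - exp (- r) * (1 + r))"
      unfolding st r cubic_form_def cA_def cK_def by (simp add: field_simps)
    have moment3_min: "moment3_min r s t = 6 - (r^2 + 4 * r + 6) * exp (- r) - r * \<mu>"
      by (simp add: moment3_min_def \<mu>_def e_def h_def algebra_simps)
    show ?thesis unfolding cubic_form moment3_min n_def by (simp add: exp_minus field_simps)
  qed
  finally show ?thesis by (simp add: zero_le_mult_iff)
qed

section \<open>The trilinear inequality for p near the critical order\<close>

locale near_critical = fixes p :: real assumes p: "1.24 \<le> p" "p \<le> 1.2415"
begin

text \<open>Alternating Taylor bounds for \<open>gap_rate p s / p\<close> in powers of (p - 1) s,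
  each coefficient rounded to its worst case over the interval for \<open>p\<close>.\<close>

lemma rate_polynomial_bounds:
  assumes "0 \<le> s" "s \<le> 2"
  shows "(1 - exp (- ((p - 1) * s))) / (p - 1) \<le> s - 12/100 * s^2 + 98/10000 * s^3"
    and "s - 12075/100000 * s^2 + 96/10000 * s^3 - 6/10000 * s^4 \<le> (1 - exp (- ((p - 1) * s))) / (p - 1)"
proof -
  define x where "x = p - 1"
  define \<sigma> where "\<sigma> = (1 - exp (- (x * s))) / x"
  have x: "24/100 \<le> x" "x \<le> 2415/10000" "0 < x" using p by (auto simp: x_def)
  have "x^2 \<le> (2415/10000)^2" "(24/100)^2 \<le> x^2" "x^3 \<le> (2415/10000)^3"
    using x by (intro power_mono; simp)+
  then have x2: "x^2/6 \<le> 98/10000" "96/10000 \<le> x^2/6" "x^3/24 \<le> 6/10000"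
    by (simp_all add: power_divide)
  have nn: "0 \<le> x * s" using x assms by simp
  have x\<sigma>: "x * \<sigma> = 1 - exp (- (x * s))" using x by (simp add: \<sigma>_def)
  have "x * \<sigma> \<le> x * s - (x* s)^2/2 + (x* s)^3/6"
    using exp_minus_bounds(2)[OF nn] x\<sigma> by linarith
  also have "\<dots> = x * (s - x/2 * s^2 + x^2/6 * s^3)"
    by (simp add: field_simps power2_eq_square power3_eq_cube)
  finally have "\<sigma> \<le> s - x/2 * s^2 + x^2/6 * s^3" using x(3) by (rule mult_left_le_imp_le)
  moreover have "12/100 * s^2 \<le> x/2 * s^2" using x by (intro mult_right_mono) simp_all
  moreover have "x^2/6 * s^3 \<le> 98/10000 * s^3"
    using x2(1) assms by (intro mult_right_mono) simp_all
  ultimately have 1: "\<sigma> \<le> s - 12/100 * s^2 + 98/10000 * s^3" by linarith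
  have "x * (s - x/2 * s^2 + x^2/6 * s^3 - x^3/24* s^4) = x * s - (x* s)^2/2 + (x* s)^3/6 - (x* s)^4/24"
    by (simp add: field_simps power2_eq_square power3_eq_cube power4_eq_xxxx)
  also have "\<dots> \<le> x * \<sigma>"
    using exp_minus_bounds(1)[OF nn] x\<sigma> by linarith
  finally have "s - x/2 * s^2 + x^2/6 * s^3 - x^3/24* s^4 \<le> \<sigma>" using x(3) by (rule mult_left_le_imp_le)
  moreover have "x/2 * s^2 \<le> 12075/100000 * s^2" using x by (intro mult_right_mono) simp_all
  moreover have "96/10000 * s^3 \<le> x^2/6 * s^3"
    using x2(2) assms by (intro mult_right_mono) simp_all
  moreover have "x^3/24 * s^4 \<le> 6/10000 * s^4"
    using x2(3) assms by (intro mult_right_mono) simp_all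
  ultimately have 2: "s - 12075/100000 * s^2 + 96/10000 * s^3 - 6/10000 * s^4 \<le> \<sigma>" by linarith
  show "(1 - exp (- ((p - 1) * s))) / (p - 1) \<le> s - 12/100 * s^2 + 98/10000 * s^3"
    "s - 12075/100000 * s^2 + 96/10000 * s^3 - 6/10000 * s^4 \<le> (1 - exp (- ((p - 1) * s))) / (p - 1)"
    using 1 2 by (simp_all only: \<sigma>_def x_def)
qed

lemma gap_rate_lower:
  assumes "0 \<le> s" "s \<le> 2"
  shows "122/100 * s - 121/1000 * s^2 \<le> gap_rate p s"
proof -
  let ?q = "s - 12075/100000 * s^2 + 96/10000 * s^3 - 6/10000 * s^4"
  have pow: "s^2 = s * s" "s^3 = s * s * s" "s^4 = s * s * s * s"
    by (simp_all add: power2_eq_square power3_eq_cube power4_eq_xxxx)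
  have "0 \<le> s * (1 - 12075/100000 * s) + s * s * s * (96/10000 - 6/10000 * s)"
    using assms by (intro add_nonneg_nonneg mult_nonneg_nonneg) auto
  also have "\<dots> = ?q" by (simp add: power_numeral_reduce field_simps)
  finally have q0: "0 \<le> ?q" .
  \<comment> \<open>Certificate: after division by s, a square plus terms that are nonnegative on
    [0, 2].\<close>
  have "0 \<le> s * ((102 * s - 141) ^ 2 / 1000000 + (1488 - 744 * s) * s^2 / 1000000
      + (12 * s ^ 2 + 34 * s + 119) / 1000000)"
    using assms by (intro mult_nonneg_nonneg add_nonneg_nonneg) auto
  also have "\<dots> = 124/100 * ?q - (122/100 * s - 121/1000 * s^2)"
    by (simp add: power_numeral_reduce field_simps)
  finally have "122/100 * s - 121/1000 * s^2 \<le> 124/100 * ?q" by simp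
  also have "\<dots> \<le> p * ?q" using p q0 by (intro mult_right_mono) auto
  also have "\<dots> \<le> p * ((1 - exp (- ((p - 1) * s))) / (p - 1))"
    using p rate_polynomial_bounds(2)[OF assms] by (intro mult_left_mono) auto
  finally show ?thesis by (simp add: gap_rate_def)
qed

text \<open>\<open>gap_min p s\<close> is \<open>mean_min s\<close> minus exp (- s) times the
  function of \<open>rate_polynomial_bounds\<close>. Multiplication by exp s leaves a polynomial
  upper bound to be compared with a Taylor lower bound of exp s - 1. The slope 6/10 lies slightly
  below p/2, the limit of gap_min / (s mean_min) at 0.\<close>

lemma gap_min_lower:
  assumes "0 \<le> s" "s \<le> 2"
  shows "(6/10 * s - 12/100 * s^2) * mean_min s \<le> gap_min p s"
proof -
  have pow: "s^2 = s * s" "s^3 = s * s * s" "s^4 = s * s * s * s" "s^5 = s * s * s * s * s"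
    by (simp_all add: power_numeral_reduce)
  let ?L = "6/10 * s - 12/100 * s^2" and ?\<sigma> = "(1 - exp (- ((p - 1) * s))) / (p - 1)"
  let ?E = "s + s^2/2 + s^3/6 + s^4/24 + s^5/120"
  have E: "?E \<le> exp s - 1"
    using sum_le_exp[OF assms(1), of 6] by (simp add: eval_nat_numeral)
  have "0 \<le> 12/100 * (s - 5/2)^2 + 1/4" by simp
  also have "\<dots> = 1 - ?L" by (simp add: power_numeral_reduce field_simps)
  finally have L: "0 \<le> 1 - ?L" .
  \<comment> \<open>The cofactor of s^2 nearly vanishes around s = 28/25, which is why the
    certificate is built on (s - 28/25)^2.\<close>
  have "0 \<le> s^2 * ((s - 28/25)^2 / 600 + (s - 28/25)^2 * (s + 56/25) / 300
      + (s - 28/25)^2 * (s^3 + 56/25 * s^2 + 2352/625 * s + 87808/15625) / 1000 + 79031/78125000 * s + 10940771/7324218750)"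
    using assms by (intro mult_nonneg_nonneg add_nonneg_nonneg divide_nonneg_nonneg) simp_all
  also have "\<dots> = (1 - ?L) * ?E - (s - 12/100 * s^2 + 98/10000 * s^3)"
    by (simp add: power_numeral_reduce field_simps)
  finally have "s - 12/100 * s^2 + 98/10000 * s^3 \<le> (1 - ?L) * ?E" by simp
  also have "\<dots> \<le> (1 - ?L) * (exp s - 1)" using E L by (intro mult_left_mono)
  finally have "?\<sigma> \<le> (1 - ?L) * (exp s - 1)" using rate_polynomial_bounds(1)[OF assms] by simp
  then have "exp (- s) * ?\<sigma> \<le> exp (- s) * ((1 - ?L) * (exp s - 1))"
    by (rule mult_left_mono) simp
  also have "\<dots> = (1 - ?L) * mean_min s" by (simp add: mean_min_def exp_minus field_simps)
  also have "\<dots> = mean_min s - ?L * mean_min s" by (simp add: left_diff_distrib)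
  finally have "exp (- s) * ?\<sigma> \<le> mean_min s - ?L * mean_min s" .
  moreover have "exp (- (p * s)) = exp (- s) * exp (- ((p - 1) * s))"
    unfolding exp_add[symmetric] by (simp add: left_diff_distrib)
  then have "gap_min p s = mean_min s - exp (- s) * ?\<sigma>"
    unfolding gap_min_def mean_min_def by (simp add: right_diff_distrib)
  ultimately show ?thesis by linarith
qed

text \<open>This is the nonnegativity of \<open>balance p r s\<close> divided by
  \<open>mean_min r * mean_min s\<close>, with polynomials in place of the transcendental terms:
  \<open>L\<close> below the quotient of gap and mean, \<open>U\<close> above x / mean_min x,
  \<open>K\<close> below \<open>gap_rate p s\<close>. The difference is a concave quadratic in r,
  hence above its chord over [0, s], and the endpoints r = 0 and r = s decide.\<close>

lemma balance_polynomial_nonneg: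
  fixes r s :: real
  assumes "0 \<le> r" "r \<le> s" "s \<le> 2"
  defines "L \<equiv> \<lambda>x. 6/10 * x - 12/100 * x^2" and "U \<equiv> \<lambda>x. 1 + x/2 + x^2/12"
    and "K \<equiv> 122/100 * s - 121/1000 * s^2"
  shows "U r * U s \<le> 1 + (L r + L s) / 2 + (1/2 + 7/2 * L r * L s) * K"
proof -
  define F where "F x = 1 + (L x + L s) / 2 + (1/2 + 7/2 * L x * L s) * K - U x * U s" for x
  have s: "0 \<le> s" using assms by simp
  have K: "0 \<le> K"
  proof -
    have "0 \<le> s * (122/100 - 121/1000 * s)" using s assms by simp
    then show ?thesis by (simp add: K_def power2_eq_square algebra_simps)
  qed
  have L: "0 \<le> L s"
  proof -
    have "0 \<le> s * (6/10 - 12/100 * s)" using s assms by simp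
    then show ?thesis by (simp add: L_def power2_eq_square algebra_simps)
  qed
  have U: "0 \<le> U s" using s by (simp add: U_def)
  have F0: "0 \<le> F 0"
  proof -
    have "0 \<le> s * (41/100 - 1223/6000 * s)" using s assms by simp
    also have "\<dots> = F 0"
      by (simp add: F_def L_def U_def K_def power2_eq_square field_simps)
    finally show ?thesis .
  qed
  have Fs: "0 \<le> F s"
  proof -
    define G where "G = (6/10 - 12/100 * s)^2 * (122/100 - 121/1000 * s)"
    have "s * s^2 \<le> 2 * s^2" using \<open>s \<le> 2\<close> by (rule mult_right_mono) simp
    then have c: "s^3/144 \<le> s^2/72" by (simp add: power_numeral_reduce)
    have le: "(6/10 - 12/100 * u)^2 * (122/100 - 121/1000 * u) \<le> G" if "s \<le> u" "u \<le> 2" for u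
      unfolding G_def using that s by (intro mult_mono power_mono) auto
    have "0 \<le> 21/100 - 3583/6000 * s - 7/72 * s^2 + 7/2 * s^2 * G"
    proof -
      \<comment> \<open>\<open>G\<close> decreases in s, so on each range it is at least its value
        at the right end, rounded down. What remains is a quadratic in s.\<close>
      consider "s \<le> 1" | "1 \<le> s" "s \<le> 3/2" | "3/2 \<le> s" by linarith
      then show ?thesis
      proof cases
        case 1
        have "s^2 * (22/100) \<le> s^2 * G" using le[of 1] 1
          by (intro mult_left_mono) (auto simp: power2_eq_square)
        then have "21/100 - 3583/6000 * s - 7/72 * s^2 + 7/2 * (s^2 * (22/100)) \<le>
          21/100 - 3583/6000 * s - 7/72 * s^2 + 7/2 * s^2 * G" by (simp add: mult_ac)
        moreover have "0 \<le> (s - 444/1000)^2 * (29064/43200) + 7/100" by simp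
        then have "0 \<le> 21/100 - 3583/6000 * s - 7/72 * s^2 + 7/2 * (s^2 * (22/100))"
          using s by (simp add: power2_eq_square field_simps)
        ultimately show ?thesis by linarith
      next
        case 2
        have "s^2 * (183/1000) \<le> s^2 * G" using le[of "3/2"] 2
          by (intro mult_left_mono) (auto simp: power2_eq_square)
        then have "21/100 - 3583/6000 * s - 7/72 * s^2 + 7/2 * (s^2 * (183/1000)) \<le>
          21/100 - 3583/6000 * s - 7/72 * s^2 + 7/2 * s^2 * G" by (simp add: mult_ac)
        moreover have "0 \<le> (s - 55/100)^2 * (54/100) + 4/100" by simp
        then have "0 \<le> 21/100 - 3583/6000 * s - 7/72 * s^2 + 7/2 * (s^2 * (183/1000))"
          using 2 by (simp add: power2_eq_square field_simps)
        ultimately show ?thesis by linarith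
      next
        case 3
        have "s^2 * (126/1000) \<le> s^2 * G" using le[of 2] assms
          by (intro mult_left_mono) (auto simp: power2_eq_square)
        then have "21/100 - 3583/6000 * s - 7/72 * s^2 + 7/2 * (s^2 * (126/1000)) \<le>
          21/100 - 3583/6000 * s - 7/72 * s^2 + 7/2 * s^2 * G" by (simp add: mult_ac)
        moreover have "0 \<le> (s - 3/2)^2" by simp
        then have "0 \<le> 21/100 - 3583/6000 * s - 7/72 * s^2 + 7/2 * (s^2 * (126/1000))"
          using 3 by (simp add: power2_eq_square field_simps)
        ultimately show ?thesis by linarith
      qed
    qed
    also have "\<dots> \<le> 21/100 - 3583/6000 * s - s^2/12 - s^3/144 + 7/2 * s^2 * G"
      using c by simp
    finally have "0 \<le> s * (21/100 - 3583/6000 * s - s^2/12 - s^3/144 + 7/2 * s^2 * G)"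
      using s by (rule mult_nonneg_nonneg[rotated])
    also have "\<dots> = F s"
      by (simp add: G_def F_def L_def U_def K_def power_numeral_reduce field_simps)
    finally show ?thesis .
  qed
  define l u where "l = L s" and "u = U s"
  have Fx: "F x = 1 + (6/10 * x - 12/100 * x^2 + l) / 2
      + (1/2 + 7/2 * (6/10 * x - 12/100 * x^2) * l) * K - (1 + x/2 + x^2/12) * u" for x
    unfolding F_def l_def u_def L_def U_def ..
  \<comment> \<open>The last summand is the exact excess of the quadratic \<open>F\<close> over its
    chord, scaled by s; its first factor is minus the leading coefficient.\<close>
  have "0 \<le> (s - r) * F 0 + r * F s + (6/100 + 42/100 * l * K + u / 12) * (r * (s - r) * s)"
    using assms s F0 Fs L K U unfolding l_def u_def by (intro add_nonneg_nonneg mult_nonneg_nonneg) auto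
  also have "\<dots> = s * F r"
    unfolding Fx by (simp add: power2_eq_square field_simps)
  finally have "0 \<le> s * F r" .
  then have "0 \<le> F r" if "0 < s" using that by (simp add: zero_le_mult_iff)
  moreover have "0 \<le> F r" if "s = 0"
    using that assms by (simp add: F_def L_def U_def K_def)
  ultimately have "0 \<le> F r" using s by fastforce
  then show ?thesis by (simp add: F_def)
qed

lemma balance_nonneg:
  assumes "0 \<le> r" "r \<le> s" "s \<le> 2"
  shows "0 \<le> balance p r s"
proof -
  define L where "L = (\<lambda>x::real. 6/10 * x - 12/100 * x^2)"
  define U where "U = (\<lambda>x::real. 1 + x/2 + x^2/12)"
  define K where "K = 122/100 * s - 121/1000 * s^2"
  have L0: "0 \<le> L x" if "0 \<le> x" "x \<le> 2" for x
  proof -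
    have "0 \<le> x * (6/10 - 12/100 * x)" using that by simp
    then show ?thesis by (simp add: L_def power2_eq_square algebra_simps)
  qed
  have rs: "0 \<le> s" "r \<le> 2" using assms by auto
  have K0: "0 \<le> K"
  proof -
    have "0 \<le> s * (122/100 - 121/1000 * s)" using rs assms by simp
    then show ?thesis by (simp add: K_def power2_eq_square algebra_simps)
  qed
  have a: "0 \<le> mean_min r" "0 \<le> mean_min s" using assms by (auto intro: mean_min_nonneg)
  have k: "L r * mean_min r \<le> gap_min p r" "L s * mean_min s \<le> gap_min p s"
    using gap_min_lower assms rs by (auto simp: L_def)
  have gap_rate: "K \<le> gap_rate p s" using gap_rate_lower assms rs by (auto simp: K_def)
  have gap_min: "0 \<le> gap_min p r" "0 \<le> gap_min p s" using gap_min_nonneg p assms by auto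
  have LL: "0 \<le> L r * mean_min r" "0 \<le> L s * mean_min s" using L0 a assms rs by auto
  have "r * s \<le> (U r * mean_min r) * (U s * mean_min s)"
    using mean_min_pade[of r] mean_min_pade[of s] assms by (intro mult_mono) (auto simp: U_def)
  also have "\<dots> = (U r * U s) * (mean_min r * mean_min s)" by simp
  also have "\<dots> \<le> (1 + (L r + L s) / 2 + (1/2 + 7/2 * L r * L s) * K) * (mean_min r * mean_min s)"
    using balance_polynomial_nonneg[OF assms] a unfolding L_def U_def K_def by (intro mult_right_mono) auto
  also have "\<dots> = mean_min r * mean_min s + (mean_min r * (L s * mean_min s) + (L r * mean_min r) * mean_min s) / 2
     + (mean_min r * mean_min s / 2 + 7/2 * ((L r * mean_min r) * (L s * mean_min s))) * K"
    by (simp add: field_simps)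
  also have "\<dots> \<le> mean_min r * mean_min s + (mean_min r * gap_min p s + gap_min p r * mean_min s) / 2
     + (mean_min r * mean_min s / 2 + 7/2 * (gap_min p r * gap_min p s)) * gap_rate p s"
    using a k LL gap_rate gap_min K0 L0[of r] L0[of s] assms rs
    by (intro add_mono mult_mono divide_right_mono order_refl add_nonneg_nonneg mult_nonneg_nonneg) auto
  finally show ?thesis unfolding balance_def by (simp add: mult.assoc)
qed

lemma cubic_form_mono:
  assumes "0 \<le> a" "0 \<le> b" "0 \<le> c" "0 \<le> k" "0 \<le> l" "0 \<le> m" "k \<le> k'" "l \<le> l'" "m \<le> m'"
  shows "cubic_form a k b l c m \<le> cubic_form a k' b l' c m'"
  unfolding cubic_form_def using assms
  by (intro add_mono mult_mono divide_right_mono order_refl mult_nonneg_nonneg) auto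

text \<open>The arguments travel from (0, 0, 0) along the diagonal to (r, r, r), then the two larger
  ones move to s, then the largest to t. On the first two legs the derivative of the difference is a
  positive multiple of \<open>balance\<close> with arguments at most 2. On the last leg only
  \<open>gap_rate\<close> keeps growing, so t may be arbitrarily large.\<close>

lemma moment3_min_le_cubic_form_small:
  assumes "0 \<le> r" "r \<le> s" "s \<le> t" "s \<le> 2"
  shows "moment3_min r s t \<le> cubic_form (mean_min r) (gap_min p r) (mean_min s) (gap_min p s) (mean_min t) (gap_min p t)"
proof -
  have p1: "p \<noteq> 1" "1 < p" using p by auto
  note d = mean_min_deriv gap_min_deriv[OF p1(1)]
  have "0 \<le> cubic_form (mean_min r) (gap_min p r) (mean_min r) (gap_min p r) (mean_min r) (gap_min p r) - moment3_min r r r"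
  proof (rule DERIV_nonneg_imp_nondecreasing[of 0 r, where f = "\<lambda>r. cubic_form (mean_min r) (gap_min p r) (mean_min r) (gap_min p r) (mean_min r) (gap_min p r) - moment3_min r r r", THEN order.trans[rotated]])
    fix x assume x: "0 \<le> x" "x \<le> r"
    have "((\<lambda>r. cubic_form (mean_min r) (gap_min p r) (mean_min r) (gap_min p r) (mean_min r) (gap_min p r) - moment3_min r r r) has_real_derivative
      3 * exp (- x) * balance p x x) (at x)"
      unfolding cubic_form_def moment3_min_def balance_def
      by (rule derivative_eq_intros d refl | simp)+ (simp add: field_simps power2_eq_square)
    moreover have "0 \<le> 3 * exp (- x) * balance p x x" using balance_nonneg[of x x] x assms by simp
    ultimately show "\<exists>y. ((\<lambda>r. cubic_form (mean_min r) (gap_min p r) (mean_min r) (gap_min p r) (mean_min r) (gap_min p r) - moment3_min r r r) has_real_derivative y) (at x) \<and> 0 \<le> y"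
      by blast
  qed (use assms in \<open>simp_all add: cubic_form_def moment3_min_def mean_min_def gap_min_def\<close>)
  also have "\<dots> \<le> cubic_form (mean_min r) (gap_min p r) (mean_min s) (gap_min p s) (mean_min s) (gap_min p s) - moment3_min r s s"
  proof (rule DERIV_nonneg_imp_nondecreasing[of r s, where f = "\<lambda>s. cubic_form (mean_min r) (gap_min p r) (mean_min s) (gap_min p s) (mean_min s) (gap_min p s) - moment3_min r s s"])
    fix x assume x: "r \<le> x" "x \<le> s"
    have "((\<lambda>s. cubic_form (mean_min r) (gap_min p r) (mean_min s) (gap_min p s) (mean_min s) (gap_min p s) - moment3_min r s s) has_real_derivative
      2 * exp (- x) * balance p r x) (at x)"
      unfolding cubic_form_def moment3_min_def balance_def
      by (rule derivative_eq_intros d refl | simp)+ (simp add: field_simps power2_eq_square)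
    moreover have "0 \<le> 2 * exp (- x) * balance p r x" using balance_nonneg[of r x] x assms by simp
    ultimately show "\<exists>y. ((\<lambda>s. cubic_form (mean_min r) (gap_min p r) (mean_min s) (gap_min p s) (mean_min s) (gap_min p s) - moment3_min r s s) has_real_derivative y) (at x) \<and> 0 \<le> y"
      by blast
  qed (use assms in simp)
  also have "\<dots> \<le> cubic_form (mean_min r) (gap_min p r) (mean_min s) (gap_min p s) (mean_min t) (gap_min p t) - moment3_min r s t"
  proof (rule DERIV_nonneg_imp_nondecreasing[of s t, where f = "\<lambda>t. cubic_form (mean_min r) (gap_min p r) (mean_min s) (gap_min p s) (mean_min t) (gap_min p t) - moment3_min r s t"])
    fix x assume x: "s \<le> x" "x \<le> t"
    let ?Q = "mean_min r * mean_min s / 2 + 7/2 * gap_min p r * gap_min p s"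
    have "((\<lambda>t. cubic_form (mean_min r) (gap_min p r) (mean_min s) (gap_min p s) (mean_min t) (gap_min p t) - moment3_min r s t) has_real_derivative
      exp (- x) * (balance p r s + ?Q * (gap_rate p x - gap_rate p s))) (at x)"
      unfolding cubic_form_def moment3_min_def balance_def
      by (rule derivative_eq_intros d refl | simp)+ (simp add: field_simps power2_eq_square)
    moreover have "0 \<le> ?Q * (gap_rate p x - gap_rate p s)"
      using gap_rate_mono[OF p1(2) x(1)] mean_min_nonneg[of r] mean_min_nonneg[of s] gap_min_nonneg[OF p1(2), of r] gap_min_nonneg[OF p1(2), of s] assms
      by (intro mult_nonneg_nonneg add_nonneg_nonneg divide_nonneg_nonneg) auto
    then have "0 \<le> exp (- x) * (balance p r s + ?Q * (gap_rate p x - gap_rate p s))"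
      using add_nonneg_nonneg[OF balance_nonneg[of r s]] assms by simp
    ultimately show "\<exists>y. ((\<lambda>t. cubic_form (mean_min r) (gap_min p r) (mean_min s) (gap_min p s) (mean_min t) (gap_min p t) - moment3_min r s t) has_real_derivative y) (at x) \<and> 0 \<le> y"
      by blast
  qed (use assms in simp)
  finally show ?thesis by simp
qed

lemma moment3_min_le_cubic_form:
  assumes "0 \<le> r" "r \<le> s" "s \<le> t"
  shows "moment3_min r s t \<le> cubic_form (mean_min r) (gap_min p r) (mean_min s) (gap_min p s) (mean_min t) (gap_min p t)"
proof (cases "s \<le> 2")
  case True
  with assms show ?thesis by (intro moment3_min_le_cubic_form_small)
next
  case False
  \<comment> \<open>1 - exp (- x) (1 + x) is the limit of \<open>gap_min p x\<close> as p tends to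
    1. It is a lower bound because 1 - exp (- y) \<le> y, and \<open>cubic_form\<close> is monotone
    in the gaps.\<close>
  have k: "0 \<le> 1 - exp (- x) * (1 + x)" "1 - exp (- x) * (1 + x) \<le> gap_min p x" if "0 \<le> x" for x
  proof -
    show "0 \<le> 1 - exp (- x) * (1 + x)"
      using exp_ge_add_one_self[of x] by (simp add: exp_minus field_simps)
    have x: "exp (- (p * x)) = exp (- x) * exp (- ((p - 1) * x))"
      by (simp add: algebra_simps flip: exp_add)
    have "1 - exp (- ((p - 1) * x)) \<le> (p - 1) * x"
      using exp_ge_add_one_self[of "- ((p - 1) * x)"] by linarith
    then have "(1 - exp (- ((p - 1) * x))) / (p - 1) \<le> x"
      using p by (simp add: pos_divide_le_eq mult.commute)
    then have "exp (- x) * ((1 - exp (- ((p - 1) * x))) / (p - 1)) \<le> exp (- x) * x"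
      by (rule mult_left_mono) simp
    then show "1 - exp (- x) * (1 + x) \<le> gap_min p x"
      unfolding gap_min_def x by (simp add: algebra_simps)
  qed
  have "moment3_min r s t \<le> cubic_form (mean_min r) (1 - exp (- r) * (1 + r)) (mean_min s) (1 - exp (- s) * (1 + s))
      (mean_min t) (1 - exp (- t) * (1 + t))"
    using moment3_min_le_cubic_form_large[OF assms] False by simp
  also have "\<dots> \<le> cubic_form (mean_min r) (gap_min p r) (mean_min s) (gap_min p s) (mean_min t) (gap_min p t)"
    using assms k mean_min_nonneg by (intro cubic_form_mono) auto
  finally show ?thesis .
qed

end

subsection \<open>Concave functions of an exponential variable\<close>

definition exp_dist :: "real measure" where
  "exp_dist = density lborel (exponential_density 1)"

interpretation exp_dist: prob_space exp_dist
  unfolding exp_dist_def by (rule prob_space_exponential_density) simp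

lemma sets_exp_dist [measurable_cong, simp]: "sets exp_dist = sets borel" and space_exp_dist [simp]: "space exp_dist = UNIV"
  by (simp_all add: exp_dist_def)

lemma AE_exp_dist_pos: "AE u in exp_dist. 0 < u"
proof -
  have "AE u in lborel. u \<noteq> (0::real)" by (rule AE_lborel_singleton)
  then show ?thesis
    unfolding exp_dist_def by (subst AE_density) (auto simp: exponential_density_def)
qed

lemma has_bochner_integral_exp_dist_power: "has_bochner_integral exp_dist (\<lambda>u. u ^ k) (fact k)"
proof -
  have "distributed exp_dist lborel (\<lambda>u. u) (exponential_density 1)"
    unfolding distributed_def exp_dist_def by (simp add: distr_id2)
  from exp_dist.has_bochner_integral_erlang_ith_moment[OF _ this, of k] show ?thesis by simp
qed

lemmas integrable_exp_dist_power [simp, intro] = has_bochner_integral_exp_dist_power[THEN integrable.intros]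
lemmas integral_exp_dist_power = has_bochner_integral_exp_dist_power[THEN has_bochner_integral_integral_eq]

lemma emeasure_exp_dist_greaterThan:
  assumes "0 \<le> a"
  shows "emeasure exp_dist {a<..} = ennreal (exp (- a))"
proof -
  have "emeasure exp_dist {..a} = ennreal (1 - exp (- a))"
    using assms unfolding exp_dist_def by (simp add: emeasure_erlang_density erlang_CDF_0)
  then have "exp_dist.prob {..a} = 1 - exp (- a)"
    using assms by (simp add: measure_def)
  moreover have "exp_dist.prob {a<..} = 1 - exp_dist.prob {..a}"
    using exp_dist.prob_compl[of "{..a}"] by (simp add: Compl_eq_Diff_UNIV[symmetric])
  ultimately show ?thesis by (simp add: exp_dist.emeasure_eq_measure)
qed

text \<open>Memorylessness of the exponential law. It evaluates integrals of functions that change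
  their formula at s.\<close>

lemma has_bochner_integral_shift:
  fixes g :: "real \<Rightarrow> real"
  assumes g [measurable]: "g \<in> borel_measurable borel" and int: "integrable exp_dist g" and "0 \<le> s"
  shows "has_bochner_integral exp_dist (\<lambda>u. if s \<le> u then g (u - s) else 0) (exp (- s) * (\<integral>u. g u \<partial>exp_dist))"
proof -
  let ?f = "\<lambda>u. exponential_density 1 u * (if s \<le> u then g (u - s) else 0)"
  have eq: "?f (s + 1 * u) = exp (- s) * (exponential_density 1 u * g u)" for u
    using assms exp_add[of "- s" "- u"] by (auto simp: exponential_density_def)
  have i: "integrable lborel (\<lambda>u. exponential_density 1 u * g u)"
    using int unfolding exp_dist_def by (subst (asm) integrable_real_density) auto
  have "has_bochner_integral lborel (\<lambda>u. ?f (s + 1 * u)) (exp (- s) * (\<integral>u. exponential_density 1 u * g u \<partial>lborel))"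
    unfolding eq using i by (intro has_bochner_integral_mult_right has_bochner_integral_integrable) auto
  then have "has_bochner_integral lborel ?f (exp (- s) * (\<integral>u. exponential_density 1 u * g u \<partial>lborel))"
    using lborel_has_bochner_integral_real_affine_iff[of 1 ?f _ s] by simp
  then show ?thesis
    unfolding exp_dist_def has_bochner_integral_iff
    by (subst integrable_real_density integral_real_density; simp)+
qed

lemma has_bochner_integral_min:
  assumes "0 \<le> s"
  shows "has_bochner_integral exp_dist (\<lambda>u. min u s) (mean_min s)"
proof -
  have "has_bochner_integral exp_dist (\<lambda>u. u ^ 1 - (if s \<le> u then (u - s) ^ 1 else 0)) (fact 1 - exp (- s) * (\<integral>u. u ^ 1 \<partial>exp_dist))"
    using assms by (intro has_bochner_integral_diff has_bochner_integral_exp_dist_power has_bochner_integral_shift integrable_exp_dist_power) auto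
  then show ?thesis
    unfolding integral_exp_dist_power by (rule has_bochner_integral_cong[THEN iffD1, rotated -1]) (auto simp: mean_min_def)
qed

lemma has_bochner_integral_min_divide:
  assumes "0 \<le> s" "0 < p"
  shows "has_bochner_integral exp_dist (\<lambda>u. min (u / p) s) (mean_min (p * s) / p)"
proof -
  have "has_bochner_integral exp_dist (\<lambda>u. min u (p * s) / p) (mean_min (p * s) / p)"
    using assms by (intro has_bochner_integral_divide_zero has_bochner_integral_min) auto
  then show ?thesis
    using assms by (simp add: min_divide_distrib_right)
qed

text \<open>Starting from u^3, each kink subtracts the difference of consecutive pieces: u^3 - r u^2
  from r on, r u^2 - r s u from s on, r s u - r s t from t on. Each is a polynomial in the distance
  to its kink, so memorylessness applies.\<close>

lemma has_bochner_integral_min3: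
  assumes "0 \<le> r" "r \<le> s" "s \<le> t"
  shows "has_bochner_integral exp_dist (\<lambda>u. min u r * min u s * min u t) (moment3_min r s t)"
proof -
  have 1: "has_bochner_integral exp_dist (\<lambda>u. (u + r)^2 * u) (6 + 4 * r + r^2)"
  proof -
    have "has_bochner_integral exp_dist (\<lambda>u. u^3 + (2 * r * u^2 + r^2 * u^1)) (fact 3 + (2 * r * fact 2 + r^2 * fact 1))"
      by (intro has_bochner_integral_add has_bochner_integral_mult_right has_bochner_integral_exp_dist_power)
    then show ?thesis by (simp add: algebra_simps power2_eq_square power3_eq_cube fact_numeral)
  qed
  have 2: "has_bochner_integral exp_dist (\<lambda>u. r * ((u + s) * u)) (r * (2 + s))"
  proof -
    have "has_bochner_integral exp_dist (\<lambda>u. r * (u^2 + s * u^1)) (r * (fact 2 + s * fact 1))"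
      by (intro has_bochner_integral_add has_bochner_integral_mult_right has_bochner_integral_exp_dist_power)
    then show ?thesis by (simp add: algebra_simps power2_eq_square fact_numeral)
  qed
  have 3: "has_bochner_integral exp_dist (\<lambda>u. r * s * u^1) (r * s * fact 1)"
    by (intro has_bochner_integral_mult_right has_bochner_integral_exp_dist_power)
  have "has_bochner_integral exp_dist (\<lambda>u. u^3
      - (if r \<le> u then (u - r + r)^2 * (u - r) else 0)
      - (if s \<le> u then r * ((u - s + s) * (u - s)) else 0)
      - (if t \<le> u then r * s * (u - t)^1 else 0))
    (fact 3 - exp (- r) * (\<integral>u. (u + r)^2 * u \<partial>exp_dist) - exp (- s) * (\<integral>u. r * ((u + s) * u) \<partial>exp_dist)
      - exp (- t) * (\<integral>u. r * s * u^1 \<partial>exp_dist))"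
    using assms 1 2 3
    by (intro has_bochner_integral_diff has_bochner_integral_exp_dist_power
        has_bochner_integral_shift[of "\<lambda>u. (u + r)^2 * u"] has_bochner_integral_shift[of "\<lambda>u. r * ((u + s) * u)"] has_bochner_integral_shift[of "\<lambda>u. r * s * u^1"])
       (auto simp: has_bochner_integral_iff)
  moreover have "fact 3 - exp (- r) * (\<integral>u. (u + r)^2 * u \<partial>exp_dist) - exp (- s) * (\<integral>u. r * ((u + s) * u) \<partial>exp_dist)
      - exp (- t) * (\<integral>u. r * s * u^1 \<partial>exp_dist) = moment3_min r s t"
    unfolding has_bochner_integral_integral_eq[OF 1] has_bochner_integral_integral_eq[OF 2]
      has_bochner_integral_integral_eq[OF 3] moment3_min_def by (simp add: fact_numeral algebra_simps)
  moreover have "u^3 - (if r \<le> u then (u - r + r)^2 * (u - r) else 0)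
      - (if s \<le> u then r * ((u - s + s) * (u - s)) else 0)
      - (if t \<le> u then r * s * (u - t)^1 else 0) = min u r * min u s * min u t" for u
    using assms by (auto simp: min_def power2_eq_square power3_eq_cube algebra_simps)
  ultimately show ?thesis by simp
qed

section \<open>Third moments of finite mixtures of truncations\<close>

context near_critical
begin

lemma integral_min3_le_cubic_form:
  assumes "0 \<le> r" "0 \<le> s" "0 \<le> t"
  shows "(\<integral>u. min u r * min u s * min u t \<partial>exp_dist) \<le> cubic_form (mean_min r) (gap_min p r) (mean_min s) (gap_min p s) (mean_min t) (gap_min p t)"
proof -
  define T where "T r s t = (\<integral>u. min u r * min u s * min u t \<partial>exp_dist)" for r s t
  define R where "R r s t = cubic_form (mean_min r) (gap_min p r) (mean_min s) (gap_min p s) (mean_min t) (gap_min p t)" for r s t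
  have T: "T r s t = T s r t" "T r s t = T r t s" for r s t
    by (simp_all add: T_def mult_ac)
  have R: "R r s t = R s r t" "R r s t = R r t s" for r s t
    by (simp_all add: R_def cubic_form_def algebra_simps)
  have le: "T r s t \<le> R r s t" if "0 \<le> r" "r \<le> s" "s \<le> t" for r s t
    using has_bochner_integral_integral_eq[OF has_bochner_integral_min3[OF that]] moment3_min_le_cubic_form[OF that]
    by (simp add: T_def R_def)
  have le2: "T r s t \<le> R r s t" if "0 \<le> r" "0 \<le> s" "0 \<le> t" "r \<le> s" for r s t
    using le[of r s t] le[of r t s] le[of t r s] that T R by (metis linorder_le_cases)
  have "T r s t \<le> R r s t"
    using le2[of r s t] le2[of s r t] assms T R by (metis linorder_le_cases)
  then show ?thesis by (simp add: T_def R_def)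
qed

lemma third_moment_sum:
  fixes c s :: "nat \<Rightarrow> real" and N :: nat
  assumes "\<And>j. 0 \<le> c j" "\<And>j. 0 \<le> s j"
  defines "y \<equiv> \<lambda>u. \<Sum>j<N. c j * min u (s j)"
  defines "A \<equiv> \<integral>u. y u \<partial>exp_dist" and "C \<equiv> \<integral>u. y (u / p) \<partial>exp_dist" and "B \<equiv> \<integral>u. y u ^ 3 \<partial>exp_dist"
  defines "K \<equiv> p / (p - 1) * (A - C)"
  shows "B \<le> A^3 + 3/2 * A^2 * K + 7/2 * K^3"
proof -
  have p0: "0 < p" "p \<noteq> 1" using p by auto
  have A: "A = (\<Sum>j<N. c j * mean_min (s j))"
    unfolding A_def y_def
    by (intro has_bochner_integral_integral_eq has_bochner_integral_sum has_bochner_integral_mult_right has_bochner_integral_min assms)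
  have C: "C = (\<Sum>j<N. c j * (mean_min (p * s j) / p))"
    unfolding C_def y_def
    by (intro has_bochner_integral_integral_eq has_bochner_integral_sum has_bochner_integral_mult_right
        has_bochner_integral_min_divide assms p0)
  have K: "K = (\<Sum>j<N. c j * gap_min p (s j))"
  proof -
    have "K = (\<Sum>j<N. p / (p - 1) * (c j * mean_min (s j) - c j * (mean_min (p * s j) / p)))"
      unfolding K_def A C sum_subtractf[symmetric] sum_distrib_left ..
    also have "\<dots> = (\<Sum>j<N. c j * gap_min p (s j))"
      using p0 by (intro sum.cong refl) (simp add: mean_min_def gap_min_def divide_simps, simp add: algebra_simps)
    finally show ?thesis .
  qed
  have int: "integrable exp_dist (\<lambda>u. c i * c j * c k * (min u (s i) * min u (s j) * min u (s k)))" for i j k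
  proof -
    define F where "F r s t \<longleftrightarrow> integrable exp_dist (\<lambda>u. min u r * min u s * min u t)" for r s t :: real
    have sym: "F r s t = F s r t" "F r s t = F r t s" for r s t
      by (simp_all add: F_def mult_ac)
    have le: "F r s t" if "0 \<le> r" "r \<le> s" "s \<le> t" for r s t
      using has_bochner_integral_min3[OF that] by (simp add: F_def has_bochner_integral_iff)
    have le2: "F r s t" if "0 \<le> r" "0 \<le> s" "0 \<le> t" "r \<le> s" for r s t
      using le[of r s t] le[of r t s] le[of t r s] that sym by (metis linorder_le_cases)
    have "F (s i) (s j) (s k)"
      using le2[of "s i" "s j" "s k"] le2[of "s j" "s i" "s k"] assms sym by (metis linorder_le_cases)
    then show ?thesis by (simp add: F_def)
  qed
  have cube: "(\<Sum>j<N. f j) * (\<Sum>j<N. g j) * (\<Sum>j<N. h j) = (\<Sum>i<N. \<Sum>j<N. \<Sum>k<N. f i * g j * h k)"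
    for f g h :: "nat \<Rightarrow> real"
    unfolding mult.assoc sum_product[of g _ h] unfolding sum_distrib_right unfolding sum_distrib_left ..
  have "y u ^ 3 = (\<Sum>i<N. \<Sum>j<N. \<Sum>k<N. c i * c j * c k * (min u (s i) * min u (s j) * min u (s k)))" for u
    unfolding y_def power3_eq_cube cube by (intro sum.cong refl) simp
  then have "B = (\<Sum>i<N. \<Sum>j<N. \<Sum>k<N. c i * c j * c k * (\<integral>u. min u (s i) * min u (s j) * min u (s k) \<partial>exp_dist))"
    unfolding B_def using int by (simp add: integral_sum integrable_sum)
  also have "\<dots> \<le> (\<Sum>i<N. \<Sum>j<N. \<Sum>k<N. c i * c j * c k *
      cubic_form (mean_min (s i)) (gap_min p (s i)) (mean_min (s j)) (gap_min p (s j)) (mean_min (s k)) (gap_min p (s k)))"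
    using assms by (intro sum_mono mult_left_mono integral_min3_le_cubic_form mult_nonneg_nonneg)
  also have "\<dots> = A * A * A + (A * A * K + A * K * A + K * A * A) / 2 + 7/2 * (K * K * K)"
    unfolding A K cube
    by (simp add: cubic_form_def sum_distrib_left sum_divide_distrib flip: sum.distrib)
       (intro sum.cong refl, simp add: field_simps)
  also have "\<dots> = A^3 + 3/2 * A^2 * K + 7/2 * K^3"
    by (simp add: power2_eq_square power3_eq_cube)
  finally show ?thesis .
qed

end

section \<open>Concave profiles and their approximation by mixtures of truncations\<close>

locale concave_profile =
  fixes x :: "real \<Rightarrow> real"
  assumes concave: "concave_on {0..} x" and mono: "mono x" and zero: "\<And>u. u \<le> 0 \<Longrightarrow> x u = 0"
begin

lemma measurable_profile [measurable]: "x \<in> borel_measurable borel"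
  using mono by (rule borel_measurable_mono)

lemma nonneg: "0 \<le> x u"
  using monoD[OF mono, of 0 u] zero[of 0] zero[of u] by (cases "0 \<le> u") auto

lemma star: "t * x u \<le> x (t * u)" if "0 \<le> t" "t \<le> 1" "0 \<le> u"
  using concave_onD[OF concave that(1,2), of 0 u] that zero[of 0] by simp

lemma growth: "0 \<le> u \<Longrightarrow> x u \<le> x 1 * (1 + u)"
proof (cases "u \<le> 1")
  case True
  assume "0 \<le> u"
  then show ?thesis
    using monoD[OF mono True] mult_left_mono[of 1 "1 + u" "x 1"] nonneg[of 1] by simp
next
  case False
  assume "0 \<le> u"
  have "1/u * x u \<le> x 1" using star[of "1/u" u] False by simp
  then have "x u \<le> x 1 * u" using False by (simp add: field_simps)
  then show ?thesis using nonneg[of 1] by (simp add: algebra_simps)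
qed

lemma integrable_exp_dist_affine:
  assumes "0 \<le> a" "0 \<le> b"
  shows "integrable exp_dist (\<lambda>u. x (a * u + b) ^ k)"
proof (rule Bochner_Integration.integrable_bound)
  show "integrable exp_dist (\<lambda>u. x 1 ^ k * (a * u + (1 + b)) ^ k)"
    unfolding binomial_ring power_mult_distrib
    by (intro integrable_mult_right integrable_sum) (simp add: mult.assoc mult.left_commute)
  show "AE u in exp_dist. norm (x (a * u + b) ^ k) \<le> norm (x 1 ^ k * (a * u + (1 + b)) ^ k)"
    using AE_exp_dist_pos
  proof eventually_elim
    fix u :: real assume "0 < u"
    then have "x (a * u + b) \<le> x 1 * (a * u + (1 + b))"
      using growth[of "a * u + b"] assms by (simp add: add.left_commute[of 1])
    then have "x (a * u + b) ^ k \<le> (x 1 * (a * u + (1 + b))) ^ k"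
      using nonneg by (intro power_mono)
    then show "norm (x (a * u + b) ^ k) \<le> norm (x 1 ^ k * (a * u + (1 + b)) ^ k)"
      using nonneg[of "a * u + b"] by (simp add: power_mult_distrib flip: power_abs)
  qed
qed simp

lemma integrable_exp_dist_profile: "integrable exp_dist (\<lambda>u. x u ^ k)" "integrable exp_dist x"
  "0 < q \<Longrightarrow> integrable exp_dist (\<lambda>u. x (u / q))"
  using integrable_exp_dist_affine[of 1 0 k] integrable_exp_dist_affine[of 1 0 1]
    integrable_exp_dist_affine[of "1/q" 0 1] by simp_all

text \<open>The profile may jump at 0, as it does for the uniform law, so continuity is claimed at
  positive arguments.\<close>

lemma isCont_profile: "0 < u \<Longrightarrow> isCont x u"
proof -
  assume "0 < u"
  have "convex_on {0<..} (\<lambda>u. - x u)"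
    using concave unfolding concave_on_def by (rule convex_on_subset) auto
  then have "continuous_on {0<..} (\<lambda>u. - x u)"
    by (intro convex_on_continuous) auto
  then have "continuous_on {0<..} (\<lambda>u. - (- x u))" by (rule continuous_on_minus)
  then show ?thesis using \<open>0 < u\<close> by (simp add: continuous_on_eq_continuous_at)
qed

text \<open>Slopes of the interpolant with mesh 1/m on [0, m], a range of m^2 cells. Beyond the grid
  the slope is 0, so that the last difference taken in \<open>approx\<close> is nonnegative
  too.\<close>

definition slope :: "nat \<Rightarrow> nat \<Rightarrow> real" where
  "slope m j = (if j < m^2 then (x ((j + 1) / m) - x (j / m)) * m else 0)"

text \<open>The piecewise linear interpolant, constant beyond m, in the form given by summation by
  parts: kinks at (j + 1)/m weighted by the drops in slope. Concavity makes these weights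
  nonnegative.\<close>

definition approx :: "nat \<Rightarrow> real \<Rightarrow> real" where
  "approx m u = (\<Sum>j<m^2. (slope m j - slope m (Suc j)) * min u ((j + 1) / m))"

lemma slope_antimono: "slope m (Suc j) \<le> slope m j"
proof (cases "Suc j < m^2")
  case True
  then have m: "0 < m" by (cases m) auto
  have "(1 - 1/2) * x (j / m) + 1/2 * x ((real j + 2) / m) \<le> x ((1 - 1/2) *\<^sub>R (real j / m) + (1/2) *\<^sub>R ((real j + 2) / m))"
    by (rule concave_onD[OF concave]) auto
  also have "(1 - 1/2) *\<^sub>R (real j / m) + (1/2) *\<^sub>R ((real j + 2) / m) = (real j + 1) / m"
    using m by (simp add: field_simps)
  finally have "x ((real j + 2) / m) - x ((real j + 1) / m) \<le> x ((real j + 1) / m) - x (j / m)" by simp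
  then have "(x ((real j + 2) / m) - x ((real j + 1) / m)) * m \<le> (x ((real j + 1) / m) - x (j / m)) * m"
    by (rule mult_right_mono) simp
  then show ?thesis using True by (simp add: slope_def add.commute)
next
  case False
  then show ?thesis
    using monoD[OF mono, of "j / m" "(j + 1) / m"]
    by (auto simp: slope_def divide_right_mono add.commute intro!: mult_nonneg_nonneg)
qed

lemma approx_eq:
  assumes "0 \<le> u"
  shows "approx m u = (\<Sum>j<m^2. slope m j * (min u ((j + 1) / m) - min u (j / m)))"
proof -
  have "(\<Sum>j<n. (slope m j - slope m (Suc j)) * min u ((j + 1) / m)) + slope m n * min u (n / m)
    = (\<Sum>j<n. slope m j * (min u ((j + 1) / m) - min u (j / m)))" for n
    using assms by (induction n) (simp_all add: algebra_simps)
  from this[of "m^2"] show ?thesis by (simp add: approx_def slope_def)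
qed

text \<open>An interpolant of a monotone function lies between the values one mesh width to either
  side. The lower bound stops at u = m, where the grid ends; the upper bound also yields the
  dominating function for the passage to the limit.\<close>

lemma approx_bounds:
  assumes "0 \<le> u" "0 < m"
  shows "0 \<le> approx m u" "approx m u \<le> x (u + 1 / m)" "u \<le> m \<Longrightarrow> x (u - 1 / m) \<le> approx m u"
proof -
  define h where "h = 1 / real m"
  define S where "S n = (\<Sum>j<n. slope m j * (min u ((j + 1) / m) - min u (j / m)))" for n
  have h: "0 < h" "h * m = 1" using assms by (auto simp: h_def)
  have jh: "real j / m = j * h" for j by (simp add: h_def)
  have sl: "slope m j * h = x (real (Suc j) * h) - x (j * h)" if "j < m^2" for j
    using that h by (simp add: slope_def h_def add.commute)
  have sl0: "0 \<le> slope m j" for j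
    using monoD[OF mono, of "j / m" "(j + 1) / m"]
    by (auto simp: slope_def divide_right_mono add.commute intro!: mult_nonneg_nonneg)
  have S_Suc: "S (Suc n) = S n + slope m n * (min u (real (Suc n) * h) - min u (n * h))" for n
    by (simp add: S_def h_def add.commute)
  have up: "S n \<le> x (min (n * h) (u + h))" if "n \<le> m^2" for n
    using that
  proof (induction n)
    case 0 then show ?case by (simp add: S_def nonneg)
  next
    case (Suc n)
    show ?case
    proof (cases "u \<le> n * h")
      case True
      moreover have "real n * h \<le> real (Suc n) * h" using h by simp
      ultimately have "S (Suc n) = S n" by (simp add: S_Suc min_absorb1)
      also have "\<dots> \<le> x (min (n * h) (u + h))" using Suc by simp
      also have "\<dots> \<le> x (min (real (Suc n) * h) (u + h))"
        using h by (intro monoD[OF mono] min.mono) auto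
      finally show ?thesis .
    next
      case False
      have "min u (real (Suc n) * h) - min u (n * h) \<le> h" using False by (auto simp: algebra_simps)
      then have "slope m n * (min u (real (Suc n) * h) - min u (n * h)) \<le> slope m n * h"
        using sl0 by (intro mult_left_mono)
      then have "S (Suc n) \<le> x (n * h) + (x (real (Suc n) * h) - x (n * h))"
        using Suc False h sl[of n] by (simp add: S_Suc min_absorb1)
      moreover have "real (Suc n) * h \<le> u + h" using False by (simp add: algebra_simps)
      ultimately show ?thesis by (simp add: min_absorb1)
    qed
  qed
  have low: "x (min (n * h) (u - h)) \<le> S n" if "n \<le> m^2" for n
    using that
  proof (induction n)
    case 0 then show ?case by (simp add: S_def zero)
  next
    case (Suc n)
    show ?case
    proof (cases "real (Suc n) * h \<le> u")
      case True
      then have "real n * h \<le> u - h" by (simp add: algebra_simps)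
      then have "x (n * h) \<le> S n" using Suc by (simp add: min_absorb1)
      moreover have "min u (real (Suc n) * h) - min u (n * h) = h"
        using True h by (simp add: min_absorb2 algebra_simps)
      ultimately have "x (real (Suc n) * h) \<le> S (Suc n)"
        using sl[of n] Suc by (simp add: S_Suc)
      moreover have "x (min (real (Suc n) * h) (u - h)) \<le> x (real (Suc n) * h)"
        by (intro monoD[OF mono]) simp
      ultimately show ?thesis by linarith
    next
      case False
      then have "u - h \<le> n * h" by (simp add: algebra_simps)
      then have "min (n * h) (u - h) = u - h" "min (real (Suc n) * h) (u - h) = u - h"
        using h by (auto simp: algebra_simps)
      moreover have "0 \<le> slope m n * (min u (real (Suc n) * h) - min u (n * h))"
        using sl0 h by (intro mult_nonneg_nonneg) (auto simp: algebra_simps)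
      ultimately show ?thesis using Suc by (simp add: S_Suc)
    qed
  qed
  have S: "approx m u = S (m^2)" using approx_eq[OF assms(1)] by (simp add: S_def)
  have mh: "real (m^2) * h = m" using h(2) by (simp add: power2_eq_square mult.commute)
  show "0 \<le> approx m u" using order.trans[OF nonneg low[of "m^2"]] S by simp
  show "approx m u \<le> x (u + 1 / m)"
    using up[of "m^2"] S monoD[OF mono, of "min (real (m^2) * h) (u + h)" "u + h"] by (simp add: h_def)
  show "x (u - 1 / m) \<le> approx m u" if "u \<le> m"
  proof -
    have "min (real (m^2) * h) (u - h) = u - h" using that h mh by simp
    then show ?thesis using low[of "m^2"] S by (simp add: h_def)
  qed
qed

lemma approx_tendsto:
  assumes "0 < u"
  shows "(\<lambda>m. approx m u) \<longlonglongrightarrow> x u"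
proof (rule tendsto_sandwich)
  have "(\<lambda>m. u - 1 / real m) \<longlonglongrightarrow> u - 0" "(\<lambda>m. u + 1 / real m) \<longlonglongrightarrow> u + 0"
    by (intro tendsto_intros lim_1_over_n)+
  then show "(\<lambda>m. x (u - 1 / real m)) \<longlonglongrightarrow> x u" "(\<lambda>m. x (u + 1 / real m)) \<longlonglongrightarrow> x u"
    using isCont_tendsto_compose[OF isCont_profile[OF assms]] by simp_all
  have "eventually (\<lambda>m. u \<le> real m \<and> 0 < m) sequentially"
    using eventually_ge_at_top[of "nat \<lceil>u\<rceil>"] eventually_gt_at_top[of 0] by eventually_elim linarith
  then show "eventually (\<lambda>m. x (u - 1 / real m) \<le> approx m u) sequentially"
    by eventually_elim (use assms approx_bounds in auto)
  show "eventually (\<lambda>m. approx m u \<le> x (u + 1 / real m)) sequentially"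
    using eventually_gt_at_top[of 0] by eventually_elim (use assms approx_bounds in auto)
qed

lemma measurable_approx [measurable]: "approx m \<in> borel_measurable borel"
  unfolding approx_def[abs_def] by measurable

lemma approx_integral_tendsto:
  assumes "0 < q"
  shows "(\<lambda>m. \<integral>u. approx (Suc m) (u / q) ^ k \<partial>exp_dist) \<longlonglongrightarrow> (\<integral>u. x (u / q) ^ k \<partial>exp_dist)"
proof (rule integral_dominated_convergence)
  show "integrable exp_dist (\<lambda>u. x (1/q * u + 1) ^ k)" using assms by (intro integrable_exp_dist_affine) auto
  show "AE u in exp_dist. (\<lambda>m. approx (Suc m) (u / q) ^ k) \<longlonglongrightarrow> x (u / q) ^ k"
    using AE_exp_dist_pos
  proof eventually_elim
    case (elim u)
    then have "(\<lambda>m. approx m (u / q)) \<longlonglongrightarrow> x (u / q)" using assms by (intro approx_tendsto) auto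
    then have "(\<lambda>m. approx (Suc m) (u / q)) \<longlonglongrightarrow> x (u / q)" by (rule LIMSEQ_Suc)
    then show ?case by (intro tendsto_intros)
  qed
  show "AE u in exp_dist. norm (approx (Suc m) (u / q) ^ k) \<le> x (1/q * u + 1) ^ k" for m
    using AE_exp_dist_pos
  proof eventually_elim
    case (elim u)
    have "approx (Suc m) (u / q) \<le> x (u / q + 1 / real (Suc m))" "0 \<le> approx (Suc m) (u / q)"
      using elim assms approx_bounds[of "u / q" "Suc m"] by auto
    moreover have "x (u / q + 1 / real (Suc m)) \<le> x (1/q * u + 1)"
      by (intro monoD[OF mono]) (simp add: field_simps)
    ultimately have "approx (Suc m) (u / q) ^ k \<le> x (1/q * u + 1) ^ k" by (intro power_mono) auto
    then show ?case using \<open>0 \<le> approx (Suc m) (u / q)\<close> by simp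
  qed
qed measurable

end

theorem (in near_critical) third_moment_bound:
  assumes "concave_profile x"
  defines "A \<equiv> \<integral>u. x u \<partial>exp_dist" and "C \<equiv> \<integral>u. x (u / p) \<partial>exp_dist" and "B \<equiv> \<integral>u. x u ^ 3 \<partial>exp_dist"
  defines "K \<equiv> p / (p - 1) * (A - C)"
  shows "B \<le> A^3 + 3/2 * A^2 * K + 7/2 * K^3"
proof -
  interpret concave_profile x by fact
  define a where "a m = (\<integral>u. approx (Suc m) u \<partial>exp_dist)" for m
  define c where "c m = (\<integral>u. approx (Suc m) (u / p) \<partial>exp_dist)" for m
  define b where "b m = (\<integral>u. approx (Suc m) u ^ 3 \<partial>exp_dist)" for m
  define k where "k m = p / (p - 1) * (a m - c m)" for m
  have "a \<longlonglongrightarrow> A" "b \<longlonglongrightarrow> B" "c \<longlonglongrightarrow> C"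
    using approx_integral_tendsto[of 1 1] approx_integral_tendsto[of 1 3] approx_integral_tendsto[of p 1] p
    by (simp_all add: a_def[abs_def] b_def[abs_def] c_def[abs_def] A_def B_def C_def)
  moreover from this have "k \<longlonglongrightarrow> K"
    unfolding k_def[abs_def] K_def by (intro tendsto_intros)
  moreover have "b m \<le> a m ^ 3 + 3/2 * a m ^ 2 * k m + 7/2 * k m ^ 3" for m
    unfolding a_def b_def c_def k_def approx_def
    by (rule third_moment_sum) (use slope_antimono in \<open>auto\<close>)
  ultimately show ?thesis
    by (intro LIMSEQ_le[of b B "\<lambda>m. a m ^ 3 + 3/2 * a m ^ 2 * k m + 7/2 * k m ^ 3"]) (auto intro!: tendsto_intros)
qed

subsection \<open>Even log-concave densities\<close>

locale even_log_concave =
  fixes F :: "real \<Rightarrow> real"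
  assumes F_measurable [measurable]: "F \<in> borel_measurable borel"
    and F_nonneg: "\<And>y. 0 \<le> F y" and F_even: "\<And>y. F (- y) = F y"
    and F_log_concave: "\<And>x y u v. \<lbrakk>0 \<le> u; 0 \<le> v; u + v = 1; 0 < F x; 0 < F y\<rbrakk> \<Longrightarrow>
      F x powr u * F y powr v \<le> F (u * x + v * y)"
    and F_total: "(\<integral>\<^sup>+y. ennreal (F y) \<partial>lborel) = 1"
begin

lemma F_le_zero: "F y \<le> F 0"
proof (cases "F y = 0")
  case True
  then show ?thesis using F_nonneg by simp
next
  case False
  then have pos: "0 < F y" using F_nonneg[of y] by simp
  have "F y = F y powr (1/2) * F (- y) powr (1/2)" using pos by (simp add: F_even flip: powr_add)
  also have "\<dots> \<le> F (1/2 * y + 1/2 * (- y))"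
    by (rule F_log_concave) (use pos in \<open>simp_all add: F_even\<close>)
  finally show ?thesis by simp
qed

lemma F_zero_pos: "0 < F 0"
proof (rule ccontr)
  assume "\<not> 0 < F 0"
  then have "F y = 0" for y using F_le_zero[of y] F_nonneg[of y] by simp
  then show False using F_total by simp
qed

lemma F_antimono:
  assumes "0 \<le> y" "y \<le> z"
  shows "F z \<le> F y"
proof (cases "F z = 0 \<or> z = 0")
  case True
  then show ?thesis using F_nonneg assms by auto
next
  case False
  then have z: "0 < F z" "0 < z" using F_nonneg[of z] assms by auto
  have "F z = F z powr (1 - y/z) * F z powr (y/z)" using z by (simp flip: powr_add)
  also have "\<dots> \<le> F 0 powr (1 - y/z) * F z powr (y/z)"
    using F_le_zero[of z] z assms by (intro mult_right_mono powr_mono2) auto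
  also have "\<dots> \<le> F ((1 - y/z) * 0 + (y/z) * z)"
    using z assms F_zero_pos by (intro F_log_concave) auto
  finally show ?thesis using z by simp
qed

section \<open>Superlevel sets and layer cake formulas\<close>

definition superlevel :: "real \<Rightarrow> real set" where
  "superlevel u = {y. 0 \<le> y \<and> F 0 * exp (- u) < F y}"

text \<open>For u \<le> 0 the superlevel set is empty, as F is largest at 0, and its supremum would
  be unspecified. The value 0 keeps the profile monotone, and concave on {0..}.\<close>

definition profile :: "real \<Rightarrow> real" where
  "profile u = (if u \<le> 0 then 0 else Sup (superlevel u))"

lemma zero_in_superlevel: "0 < u \<Longrightarrow> 0 \<in> superlevel u"
  using F_zero_pos by (simp add: superlevel_def)

text \<open>Markov's inequality: on [0, y] the density is at least F 0 * exp (- u), and its total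
  mass is 1.\<close>

lemma superlevel_bound:
  assumes "y \<in> superlevel u"
  shows "y \<le> exp u / F 0"
proof -
  have y: "0 \<le> y" "F 0 * exp (- u) < F y" using assms by (auto simp: superlevel_def)
  have "ennreal (F 0 * exp (- u) * y) = (\<integral>\<^sup>+z. ennreal (F 0 * exp (- u)) * indicator {0..y} z \<partial>lborel)"
    using y F_zero_pos by (simp add: nn_integral_cmult ennreal_mult)
  also have "\<dots> \<le> (\<integral>\<^sup>+z. ennreal (F z) \<partial>lborel)"
  proof (rule nn_integral_mono)
    fix z
    have "F 0 * exp (- u) \<le> F z" if "z \<in> {0..y}"
      using y(2) F_antimono[of z y] that by simp
    then show "ennreal (F 0 * exp (- u)) * indicator {0..y} z \<le> ennreal (F z)"
      by (cases "z \<in> {0..y}") (simp_all add: ennreal_leI)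
  qed
  finally have "ennreal (F 0 * exp (- u) * y) \<le> 1" using F_total by simp
  then have "F 0 * exp (- u) * y \<le> 1" by simp
  then show ?thesis using F_zero_pos by (simp add: exp_minus field_simps)
qed

lemma bdd_above_superlevel: "bdd_above (superlevel u)"
  using superlevel_bound by (rule bdd_aboveI)

lemma profile_upper: "0 < u \<Longrightarrow> F 0 * exp (- u) < F y \<Longrightarrow> \<bar>y\<bar> \<le> profile u"
  unfolding profile_def using cSup_upper[OF _ bdd_above_superlevel, of "\<bar>y\<bar>" u]
  by (auto simp: superlevel_def abs_if F_even)

lemma profile_lower:
  assumes "\<bar>y\<bar> < profile u"
  shows "F 0 * exp (- u) < F y"
proof -
  have u: "0 < u" using assms by (simp add: profile_def split: if_splits)
  then have "\<bar>y\<bar> < Sup (superlevel u)" using assms by (simp add: profile_def)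
  then obtain z where z: "z \<in> superlevel u" "\<bar>y\<bar> < z"
    using less_cSupD zero_in_superlevel[OF u] by (metis empty_iff)
  then have "F z \<le> F \<bar>y\<bar>" by (intro F_antimono) auto
  also have "F \<bar>y\<bar> = F y" by (simp add: abs_if F_even)
  finally show ?thesis using z by (simp add: superlevel_def)
qed

text \<open>At level a = 0 only the weak inequality can hold, since no value of F exceeds F 0. One
  strict factor suffices for a strict product, hence the assumption that a or b is positive.\<close>

lemma superlevel_convex_comb:
  assumes "0 \<le> a" "0 \<le> b" "0 < u" "0 < v" "u + v = 1" "0 < a \<or> 0 < b"
    and y: "F 0 * exp (- a) \<le> F y" "0 < a \<Longrightarrow> F 0 * exp (- a) < F y"
    and z: "F 0 * exp (- b) \<le> F z" "0 < b \<Longrightarrow> F 0 * exp (- b) < F z"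
  shows "F 0 * exp (- (u * a + v * b)) < F (u * y + v * z)"
proof -
  have pos: "0 < F 0 * exp (- a)" "0 < F 0 * exp (- b)" using F_zero_pos by auto
  have "F 0 * exp (- (u * a + v * b)) = F 0 powr (u + v) * exp (- (u * a + v * b))"
    using assms F_zero_pos by simp
  also have "\<dots> = (F 0 * exp (- a)) powr u * (F 0 * exp (- b)) powr v"
  proof -
    have "exp (- (u * a + v * b)) = exp (- a) powr u * exp (- b) powr v"
      by (simp add: powr_def algebra_simps flip: exp_add)
    then show ?thesis using F_zero_pos by (simp add: powr_mult powr_add mult_ac)
  qed
  also have "\<dots> < F y powr u * F z powr v"
  proof -
    have le: "(F 0 * exp (- a)) powr u \<le> F y powr u" "(F 0 * exp (- b)) powr v \<le> F z powr v"
      using assms pos by (auto intro!: powr_mono2)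
    have "0 < F y powr u" "0 < F z powr v" "0 < (F 0 * exp (- a)) powr u" "0 < (F 0 * exp (- b)) powr v"
      using pos y(1) z(1) by auto
    moreover have "(F 0 * exp (- a)) powr u < F y powr u \<or> (F 0 * exp (- b)) powr v < F z powr v"
      using assms pos by (auto intro!: powr_less_mono2)
    ultimately show ?thesis using le by (auto intro: mult_less_le_imp_less mult_le_less_imp_less)
  qed
  also have "\<dots> \<le> F (u * y + v * z)"
    using assms pos by (intro F_log_concave) auto
  finally show ?thesis .
qed

sublocale profile: concave_profile profile
proof
  show "profile u = 0" if "u \<le> 0" for u using that by (simp add: profile_def)
  show "mono profile"
  proof
    fix u v :: real assume "u \<le> v"
    consider "v \<le> 0" | "u \<le> 0" "0 < v" | "0 < u" using \<open>u \<le> v\<close> by linarith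
    then show "profile u \<le> profile v"
    proof cases
      case 2
      then show ?thesis
        using cSup_upper[OF zero_in_superlevel[of v] bdd_above_superlevel[of v]] by (simp add: profile_def)
    next
      case 3
      have "exp (- v) \<le> exp (- u)" using \<open>u \<le> v\<close> by simp
      then have "F 0 * exp (- v) \<le> F 0 * exp (- u)" using F_zero_pos by (intro mult_left_mono) auto
      then have "superlevel u \<subseteq> superlevel v" by (auto simp: superlevel_def)
      then have "Sup (superlevel u) \<le> Sup (superlevel v)"
        using 3 zero_in_superlevel by (intro cSup_subset_mono bdd_above_superlevel) auto
      then show ?thesis using 3 \<open>u \<le> v\<close> by (simp add: profile_def)
    qed (use \<open>u \<le> v\<close> in \<open>simp add: profile_def\<close>)
  qed
  \<comment> \<open>\<open>{0}\<close> replaces the empty set at nonpositive levels, so every value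
    of \<open>profile\<close> is the supremum of a nonempty set, and one of the two levels may be 0
    in the main case.\<close>
  define P where "P a = (if a \<le> 0 then {0} else superlevel a)" for a
  have P: "profile a = Sup (P a)" "P a \<noteq> {}" for a
    using zero_in_superlevel[of a] by (auto simp: profile_def P_def)
  have Pmem: "F 0 * exp (- a) \<le> F y" "0 < a \<Longrightarrow> F 0 * exp (- a) < F y" "0 \<le> y"
    if "y \<in> P a" "0 \<le> a" for a y
    using that by (auto simp: P_def superlevel_def split: if_splits)
  show "concave_on {0..} profile"
    unfolding concave_on_iff
  proof (intro conjI ballI allI impI)
    fix a b u v :: real
    assume ab: "a \<in> {0..}" "b \<in> {0..}" and uv: "0 \<le> u" "0 \<le> v" "u + v = 1"
    let ?c = "u * a + v * b"
    consider "u = 0" | "v = 0" | "a = 0" "b = 0" | "0 < u" "0 < v" "0 < a \<or> 0 < b"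
      using ab uv by (auto simp: less_le)
    then show "u * profile a + v * profile b \<le> profile (u *\<^sub>R a + v *\<^sub>R b)"
    proof cases
      case 4
      have c: "0 < ?c" using 4 ab by (auto intro: add_pos_nonneg add_nonneg_pos)
      have comb: "u * y + v * z \<le> profile ?c" if y: "y \<in> P a" and z: "z \<in> P b" for y z
      proof -
        have "F 0 * exp (- ?c) < F (u * y + v * z)"
          using ab 4 uv by (intro superlevel_convex_comb Pmem[OF y] Pmem[OF z]) auto
        then show ?thesis using profile_upper[OF c] by (meson abs_le_D1)
      qed
      \<comment> \<open>The two suprema are taken one after the other: over y with z fixed, then
        over z.\<close>
      have "z \<le> (profile ?c - u * profile a) / v" if z: "z \<in> P b" for z
      proof -
        have "Sup (P a) \<le> (profile ?c - v * z) / u"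
        proof (intro cSup_least P)
          fix y assume "y \<in> P a"
          from comb[OF this z] 4 show "y \<le> (profile ?c - v * z) / u"
            by (simp add: pos_le_divide_eq mult.commute)
        qed
        then show ?thesis using 4 unfolding P(1)[of a] by (simp add: pos_le_divide_eq mult.commute)
      qed
      then have "Sup (P b) \<le> (profile ?c - u * profile a) / v" by (intro cSup_least P)
      then show ?thesis using 4 unfolding P(1)[of b] by (simp add: pos_le_divide_eq mult.commute)
    qed (use uv in \<open>simp_all add: profile_def\<close>)
  qed simp
qed

text \<open>Writing F y = F 0 * exp (- (a / q)), the condition on v becomes v > a, an event of
  probability exp (- a) = (F y / F 0)^q.\<close>

lemma powr_layer_cake:
  assumes "0 < q"
  shows "ennreal (F y powr q) = (\<integral>\<^sup>+v. ennreal (F 0 powr q) * (if F 0 * exp (- (v / q)) < F y then 1 else 0) \<partial>exp_dist)"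
proof (cases "F y = 0")
  case True
  have "\<not> F 0 * exp (- (v / q)) < 0" for v using F_zero_pos by (simp add: not_less)
  then show ?thesis using True assms by simp
next
  case False
  define a where "a = q * ln (F 0 / F y)"
  have Fy: "0 < F y" using False F_nonneg[of y] by simp
  have a: "0 \<le> a" using Fy F_le_zero[of y] F_zero_pos assms by (simp add: a_def)
  have Fy_eq: "F y = F 0 * exp (- (a / q))"
    using Fy F_zero_pos assms by (simp add: a_def exp_minus)
  have "(if F 0 * exp (- (v / q)) < F y then 1 else 0) = (indicator {a<..} v :: ennreal)" for v
    unfolding Fy_eq using F_zero_pos assms by (auto simp: divide_less_cancel indicator_def)
  moreover have "F y powr q = F 0 powr q * exp (- a)"
    unfolding Fy_eq using F_zero_pos assms by (simp add: powr_mult exp_powr_real)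
  ultimately show ?thesis
    using emeasure_exp_dist_greaterThan[OF a] F_zero_pos by (simp add: nn_integral_cmult ennreal_mult)
qed

lemma nn_integral_layer_cake:
  fixes \<psi> :: "real \<Rightarrow> ennreal"
  assumes "0 < q" and [measurable]: "\<psi> \<in> borel_measurable borel"
  shows "(\<integral>\<^sup>+y. \<psi> y * ennreal (F y powr q) \<partial>lborel) =
    (\<integral>\<^sup>+v. ennreal (F 0 powr q) * (\<integral>\<^sup>+y. \<psi> y * indicator {- profile (v / q) .. profile (v / q)} y \<partial>lborel) \<partial>exp_dist)"
proof -
  interpret pair: pair_sigma_finite exp_dist lborel ..
  let ?I = "\<lambda>v y. if F 0 * exp (- (v / q)) < F y then 1 else 0 :: ennreal"
  have "(\<integral>\<^sup>+y. \<psi> y * ennreal (F y powr q) \<partial>lborel) =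
      (\<integral>\<^sup>+y. (\<integral>\<^sup>+v. \<psi> y * (ennreal (F 0 powr q) * ?I v y) \<partial>exp_dist) \<partial>lborel)"
  proof (rule nn_integral_cong)
    fix y
    show "\<psi> y * ennreal (F y powr q) = (\<integral>\<^sup>+v. \<psi> y * (ennreal (F 0 powr q) * ?I v y) \<partial>exp_dist)"
      unfolding powr_layer_cake[OF assms(1), of y] by (rule nn_integral_cmult[symmetric]) measurable
  qed
  also have "\<dots> = (\<integral>\<^sup>+v. (\<integral>\<^sup>+y. \<psi> y * (ennreal (F 0 powr q) * ?I v y) \<partial>lborel) \<partial>exp_dist)"
    by (rule pair.Fubini') measurable
  also have "\<dots> = (\<integral>\<^sup>+v. ennreal (F 0 powr q) * (\<integral>\<^sup>+y. \<psi> y * indicator {- profile (v / q) .. profile (v / q)} y \<partial>lborel) \<partial>exp_dist)"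
  proof (rule nn_integral_cong_AE, use AE_exp_dist_pos in eventually_elim)
    fix v :: real assume "0 < v"
    let ?X = "profile (v / q)"
    \<comment> \<open>\<open>profile_lower\<close> and \<open>profile_upper\<close> decide
      membership except at the two endpoints, which form a null set.\<close>
    have "AE y in lborel. y \<noteq> ?X" "AE y in lborel. y \<noteq> - ?X" by (rule AE_lborel_singleton)+
    then have "AE y in lborel. ?I v y = indicator {- ?X .. ?X} y"
    proof eventually_elim
      case (elim y)
      then have "\<bar>y\<bar> < ?X \<or> ?X < \<bar>y\<bar>" by linarith
      then show ?case
      proof
        assume y: "\<bar>y\<bar> < ?X"
        then have "y \<in> {- ?X .. ?X}" by auto
        then show ?thesis using profile_lower[OF y] by simp
      next
        assume y: "?X < \<bar>y\<bar>"
        then have "y \<notin> {- ?X .. ?X}" by auto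
        moreover have "\<not> F 0 * exp (- (v / q)) < F y"
          using profile_upper[of "v / q" y] y \<open>0 < v\<close> assms(1) by auto
        ultimately show ?thesis by simp
      qed
    qed
    then have "(\<integral>\<^sup>+y. \<psi> y * (ennreal (F 0 powr q) * ?I v y) \<partial>lborel) =
        (\<integral>\<^sup>+y. ennreal (F 0 powr q) * (\<psi> y * indicator {- ?X .. ?X} y) \<partial>lborel)"
      by (intro nn_integral_cong_AE) (auto simp: mult_ac)
    then show "(\<integral>\<^sup>+y. \<psi> y * (ennreal (F 0 powr q) * ?I v y) \<partial>lborel) =
        ennreal (F 0 powr q) * (\<integral>\<^sup>+y. \<psi> y * indicator {- ?X .. ?X} y \<partial>lborel)"
      by (simp add: nn_integral_cmult)
  qed
  finally show ?thesis .
qed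

lemma has_bochner_integral_powr:
  assumes "0 < q"
  shows "has_bochner_integral lborel (\<lambda>y. F y powr q) (2 * F 0 powr q * (\<integral>u. profile (u / q) \<partial>exp_dist))"
proof (rule has_bochner_integral_nn_integral)
  have "(\<integral>\<^sup>+y. ennreal (F y powr q) \<partial>lborel) = (\<integral>\<^sup>+v. ennreal (2 * F 0 powr q * profile (v / q)) \<partial>exp_dist)"
    using nn_integral_layer_cake[OF assms, of "\<lambda>_. 1"] profile.nonneg
    by (simp add: mult_ac flip: ennreal_mult)
  also have "\<dots> = ennreal (\<integral>v. 2 * F 0 powr q * profile (v / q) \<partial>exp_dist)"
    using profile.nonneg profile.integrable_exp_dist_profile(3)[OF assms] by (intro nn_integral_eq_integral) auto
  finally show "(\<integral>\<^sup>+y. ennreal (F y powr q) \<partial>lborel) = ennreal (2 * F 0 powr q * (\<integral>u. profile (u / q) \<partial>exp_dist))"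
    by simp
qed (auto intro!: integral_nonneg_AE mult_nonneg_nonneg simp: profile.nonneg)

lemma has_bochner_integral_square:
  "has_bochner_integral lborel (\<lambda>y. y^2 * F y) (2/3 * F 0 * (\<integral>u. profile u ^ 3 \<partial>exp_dist))"
proof (rule has_bochner_integral_nn_integral)
  have sq: "(\<integral>\<^sup>+y. ennreal (y^2) * indicator {- X..X} y \<partial>lborel) = ennreal (2/3 * X^3)" if "0 \<le> X" for X :: real
  proof -
    have "(\<integral>\<^sup>+y. ennreal (y^2) * indicator {- X..X} y \<partial>lborel) = ennreal (X^3/3 - (- X)^3/3)"
      using that by (intro nn_integral_FTC_Icc) (auto intro!: derivative_eq_intros)
    then show ?thesis by (simp add: power3_eq_cube mult.assoc)
  qed
  have "(\<integral>\<^sup>+y. ennreal (y^2 * F y) \<partial>lborel) = (\<integral>\<^sup>+y. ennreal (y^2) * ennreal (F y powr 1) \<partial>lborel)"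
    using F_nonneg by (simp add: ennreal_mult)
  also have "\<dots> = (\<integral>\<^sup>+v. ennreal (2/3 * F 0 * profile v ^ 3) \<partial>exp_dist)"
    using profile.nonneg F_zero_pos
    by (subst nn_integral_layer_cake) (auto simp: sq mult_ac simp flip: ennreal_mult)
  also have "\<dots> = ennreal (\<integral>v. 2/3 * F 0 * profile v ^ 3 \<partial>exp_dist)"
    using profile.nonneg F_zero_pos profile.integrable_exp_dist_profile(1)[of 3]
    by (intro nn_integral_eq_integral) auto
  finally show "(\<integral>\<^sup>+y. ennreal (y^2 * F y) \<partial>lborel) = ennreal (2/3 * F 0 * (\<integral>u. profile u ^ 3 \<partial>exp_dist))"
    by simp
qed (use F_nonneg F_zero_pos profile.nonneg in \<open>auto intro!: integral_nonneg_AE mult_nonneg_nonneg\<close>)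

end

subsection \<open>The critical order\<close>

text \<open>The quotient is the slope of a chord of ln from the point 1, decreasing by strict
  concavity. Arguments on different sides of 1 are separated by the value 1, the slope of ln at
  1.\<close>

lemma ln_quotient_strict_antimono:
  fixes a b :: real
  assumes "0 < a" "a < b" "a \<noteq> 1" "b \<noteq> 1"
  shows "ln b / (b - 1) < ln a / (a - 1)"
proof -
  have less: "ln x < x - 1" if "0 < x" "x \<noteq> 1" for x :: real
    using ln_le_minus_one[of x] ln_eq_minus_one[of x] that by fastforce
  have dec: "ln y / (y - 1) < ln x / (x - 1)" if "0 < x" "x < y" "y < 1 \<or> 1 < x" for x y :: real
  proof (rule DERIV_neg_imp_decreasing[OF \<open>x < y\<close>])
    fix z assume z: "x \<le> z" "z \<le> y"
    have z1: "0 < z" "z \<noteq> 1" using z that by auto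
    have "ln (1 / z) < 1 / z - 1" using z1 by (intro less) auto
    then have "1 / z * (z - 1) - ln z < 0" using z1 by (simp add: ln_div field_simps)
    then have "(1 / z * (z - 1) - ln z) / (z - 1)^2 < 0" using z1 by (intro divide_neg_pos) auto
    moreover have "((\<lambda>z. ln z / (z - 1)) has_real_derivative (1 / z * (z - 1) - ln z) / (z - 1)^2) (at z)"
      using z1 by (auto intro!: derivative_eq_intros simp: power2_eq_square)
    ultimately show "\<exists>d. ((\<lambda>z. ln z / (z - 1)) has_real_derivative d) (at z) \<and> d < 0" by blast
  qed
  show ?thesis
  proof (cases "b < 1 \<or> 1 < a")
    case True
    then show ?thesis using dec assms by blast
  next
    case False
    then have "a < 1" "1 < b" using assms by auto
    then have "ln b / (b - 1) < 1" "1 < ln a / (a - 1)"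
      using less[of a] less[of b] assms by (simp_all add: field_simps)
    then show ?thesis by linarith
  qed
qed

lemma critical_order_bracket:
  "ln 1.2415 / 0.2415 < ln 6 / (2::real)" "ln 6 / 2 < ln 1.2405 / (0.2405::real)"
proof -
  have 2: "ln (2::real) \<in> {693146/1000000..693148/1000000}"
    using ln_approx_bounds[of 2 6] by (simp add: eval_nat_numeral)
  have 3: "ln (3/2::real) \<in> {405465/1000000..405466/1000000}"
    using ln_approx_bounds[of "3/2" 5] by (simp add: eval_nat_numeral)
  \<comment> \<open>Splitting 6 keeps the arguments of the logarithm close to 1, where few terms of
    the approximation suffice.\<close>
  have 6: "ln (6::real) = 2 * ln 2 + ln (3/2)"
    using ln_mult[of 2 "3::real"] ln_mult[of 2 "3/2::real"] by simp
  have a: "ln (1.2405::real) \<in> {215505/1000000..21552/100000}"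
    using ln_approx_bounds[of "1.2405" 2] by (simp add: eval_nat_numeral)
  have b: "ln (1.2415::real) \<in> {21631/100000..216325/1000000}"
    using ln_approx_bounds[of "1.2415" 2] by (simp add: eval_nat_numeral)
  show "ln 1.2415 / 0.2415 < ln 6 / (2::real)" using 2 3 6 b by simp
  show "ln 6 / 2 < ln 1.2405 / (0.2405::real)" using 2 3 6 a by simp
qed

lemma ex_critical_order: "\<exists>a. 1.2405 < a \<and> a < 1.2415 \<and> is_critical_order a"
proof -
  have "\<exists>a\<ge>1.2405. a \<le> 1.2415 \<and> ln a / (a - 1) = ln 6 / (2::real)"
    using critical_order_bracket by (intro IVT2' continuous_intros) auto
  then obtain a :: real where a: "1.2405 \<le> a" "a \<le> 1.2415" "ln a / (a - 1) = ln 6 / 2" by blast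
  moreover have "a \<noteq> 1.2405"
  proof
    assume "a = 1.2405"
    with a(3) critical_order_bracket show False by simp
  qed
  moreover have "a \<noteq> 1.2415"
  proof
    assume "a = 1.2415"
    with a(3) critical_order_bracket show False by simp
  qed
  ultimately show ?thesis by (intro exI[of _ a]) (auto simp: is_critical_order_def)
qed

lemma critical_order_unique:
  assumes "is_critical_order a" "is_critical_order b"
  shows "a = b"
proof -
  have "ln x / (x - 1) = 1 / (x - 1) * ln x" for x :: real by simp
  then have "ln a / (a - 1) = ln b / (b - 1)" "0 < a" "0 < b" "a \<noteq> 1" "b \<noteq> 1"
    using assms unfolding is_critical_order_def by metis+
  then show ?thesis
    using ln_quotient_strict_antimono[of a b] ln_quotient_strict_antimono[of b a] by (metis less_irrefl linorder_neqE)
qed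

lemma ex1_critical_order: "\<exists>!a. is_critical_order a"
  using ex_critical_order critical_order_unique by blast

lemma alpha_star:
  shows critical_alpha_star: "is_critical_order alpha_star"
    and alpha_star_bounds: "1.2405 < alpha_star" "alpha_star < 1.2415"
proof -
  show *: "is_critical_order alpha_star"
    unfolding alpha_star_def by (rule theI'[OF ex1_critical_order])
  show "1.2405 < alpha_star" "alpha_star < 1.2415"
    using ex_critical_order critical_order_unique[OF *] by auto
qed

text \<open>The difference f of the two sides vanishes at 0, and by criticality at 1. Its derivative
  has the sign of (1 - x) Q x: the factor 1 - x comes from the matched slope at 1, and Q is a
  concave quadratic, positive at 0 (since p < 4/3) and negative at 1. So f first increases and then
  decreases, and is positive in between.\<close>

lemma log_cubic_less:
  fixes p r :: real
  assumes p: "1 < p" "p < 4/3" and crit: "(p - 1) / 2 * ln 6 = ln p" and r: "0 < r" "r < 1"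
  shows "(p - 1) / 2 * ln (1 + 3/2 * r + 7/2 * r^3) < - ln (1 - (1 - 1/p) * r)"
proof -
  define \<theta> where "\<theta> = (p - 1) / 2"
  define f where "f x = - ln (1 - (1 - 1/p) * x) - \<theta> * ln (1 + 3/2 * x + 7/2 * x^3)" for x
  define Q where "Q x = 1/2 - 3 * \<theta> + 7/2 * x - (7 + 21 * \<theta>) * x^2" for x
  define den where "den x = (p - 2 * \<theta> * x) * (1 + 3/2 * x + 7/2 * x^3)" for x
  have \<theta>: "0 < \<theta>" "\<theta> < 1/6" "p = 1 + 2 * \<theta>" using p by (simp_all add: \<theta>_def field_simps)
  have pos1: "0 < p - 2 * \<theta> * x" if "0 \<le> x" "x \<le> 1" for x
  proof -
    have "2 * \<theta> * x \<le> 2 * \<theta> * 1" using that \<theta> by (intro mult_left_mono) auto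
    then show ?thesis using \<theta> by linarith
  qed
  have pos: "0 < p - 2 * \<theta> * x" "0 < 1 + 3/2 * x + 7/2 * x^3" "0 < 1 - (1 - 1/p) * x" if "0 \<le> x" "x \<le> 1" for x
  proof -
    show "0 < p - 2 * \<theta> * x" using pos1 that .
    show "0 < 1 + 3/2 * x + 7/2 * x^3" using that by (intro add_pos_nonneg) auto
    have "1 - (1 - 1/p) * x = (p - 2 * \<theta> * x) / p" using \<theta> p by (simp add: field_simps)
    then show "0 < 1 - (1 - 1/p) * x" using pos1[OF that] p by simp
  qed
  have deriv: "(f has_real_derivative \<theta> * (1 - x) * Q x / den x) (at x)" if x: "0 \<le> x" "x \<le> 1" for x
  proof -
    have "(f has_real_derivative (1 - 1/p) / (1 - (1 - 1/p) * x)
        - \<theta> * ((3/2 + 21/2 * x^2) / (1 + 3/2 * x + 7/2 * x^3))) (at x)"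
      unfolding f_def[abs_def] using pos[OF x]
      by (auto intro!: derivative_eq_intros simp: minus_divide_left mult.commute)
    moreover have "(1 - 1/p) / (1 - (1 - 1/p) * x) = \<theta> * (2 / (p - 2 * \<theta> * x))"
    proof -
      have "1 - (1 - 1/p) * x = (p - 2 * \<theta> * x) / p" "1 - 1/p = 2 * \<theta> / p" using \<theta> p by (simp_all add: field_simps)
      then show ?thesis using p by simp
    qed
    moreover have "\<theta> * (2 / (p - 2 * \<theta> * x)) - \<theta> * ((3/2 + 21/2 * x^2) / (1 + 3/2 * x + 7/2 * x^3))
        = \<theta> * (1 - x) * Q x / den x"
    proof -
      have "2 / (p - 2 * \<theta> * x) - (3/2 + 21/2 * x^2) / (1 + 3/2 * x + 7/2 * x^3)
          = (2 * (1 + 3/2 * x + 7/2 * x^3) - (3/2 + 21/2 * x^2) * (p - 2 * \<theta> * x)) / den x"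
        using pos[OF x] by (simp add: den_def diff_frac_eq)
      also have "2 * (1 + 3/2 * x + 7/2 * x^3) - (3/2 + 21/2 * x^2) * (p - 2 * \<theta> * x) = (1 - x) * Q x"
        unfolding \<theta>(3) Q_def by (simp add: power_numeral_reduce field_simps)
      finally have eq: "2 / (p - 2 * \<theta> * x) - (3/2 + 21/2 * x^2) / (1 + 3/2 * x + 7/2 * x^3) = (1 - x) * Q x / den x" .
      show ?thesis unfolding right_diff_distrib[symmetric] eq by simp
    qed
    ultimately show ?thesis by simp
  qed
  have den: "0 < den x" if "0 \<le> x" "x \<le> 1" for x using pos[OF that] by (simp add: den_def)
  have "\<exists>x\<ge>0. x \<le> 1 \<and> Q x = 0"
    using \<theta> unfolding Q_def by (intro IVT2' continuous_intros) auto
  then obtain \<rho> where \<rho>: "0 \<le> \<rho>" "\<rho> \<le> 1" "Q \<rho> = 0" by blast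
  have big: "7/2 < (7 + 21 * \<theta>) * \<rho>"
  proof -
    have "\<rho> * (7/2 - (7 + 21 * \<theta>) * \<rho>) = Q \<rho> - (1/2 - 3 * \<theta>)"
      by (simp add: Q_def power2_eq_square algebra_simps)
    then have "\<rho> * (7/2 - (7 + 21 * \<theta>) * \<rho>) < 0" using \<rho> \<theta> by simp
    then show ?thesis using \<rho> by (simp add: mult_less_0_iff)
  qed
  have Q: "Q x = (\<rho> - x) * ((7 + 21 * \<theta>) * (x + \<rho>) - 7/2)" for x
  proof -
    have "Q x = Q x - Q \<rho>" using \<rho> by simp
    also have "\<dots> = (\<rho> - x) * ((7 + 21 * \<theta>) * (x + \<rho>) - 7/2)"
      by (simp add: Q_def power2_eq_square algebra_simps diff_divide_distrib)
    finally show ?thesis .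
  qed
  have Qpos: "0 < (7 + 21 * \<theta>) * (x + \<rho>) - 7/2" if "0 \<le> x" for x
  proof -
    have "(7 + 21 * \<theta>) * \<rho> \<le> (7 + 21 * \<theta>) * (x + \<rho>)" using that \<theta> by (intro mult_left_mono) auto
    then show ?thesis using big by simp
  qed
  have cont: "continuous_on {a..b} f" if "0 \<le> a" "b \<le> 1" for a b
  proof (rule continuous_at_imp_continuous_on, rule ballI)
    fix x assume "x \<in> {a..b}"
    then have "0 \<le> x" "x \<le> 1" using that by auto
    then show "isCont f x" using deriv DERIV_isCont by blast
  qed
  have f01: "f 0 = 0" "f 1 = 0"
    using crit p by (simp_all add: f_def \<theta>_def ln_div)
  have "0 < f r"
  proof (cases "r \<le> \<rho>")
    case True
    have "f 0 < f r"
    proof (rule DERIV_pos_imp_increasing_open[OF r(1)])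
      fix x assume x: "0 < x" "x < r"
      have "0 < \<theta> * (1 - x) * Q x / den x"
        using x True r \<theta> Qpos[of x] den[of x] unfolding Q by (intro divide_pos_pos mult_pos_pos) auto
      then show "\<exists>y. (f has_real_derivative y) (at x) \<and> 0 < y" using deriv[of x] x r by auto
    qed (use cont r in auto)
    then show ?thesis using f01 by simp
  next
    case False
    have "f 1 < f r"
    proof (rule DERIV_neg_imp_decreasing_open[OF r(2)])
      fix x assume x: "r < x" "x < 1"
      have "0 < \<theta> * (1 - x) * ((x - \<rho>) * ((7 + 21 * \<theta>) * (x + \<rho>) - 7/2)) / den x"
        using x False r \<theta> Qpos[of x] den[of x] by (intro divide_pos_pos mult_pos_pos) auto
      also have "(x - \<rho>) * ((7 + 21 * \<theta>) * (x + \<rho>) - 7/2) = - Q x"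
        unfolding Q minus_mult_left by simp
      finally have "\<theta> * (1 - x) * Q x / den x < 0" by simp
      then show "\<exists>y. (f has_real_derivative y) (at x) \<and> y < 0" using deriv[of x] x r by auto
    qed (use cont r in auto)
    then show ?thesis using f01 by simp
  qed
  then show ?thesis by (simp add: f_def \<theta>_def)
qed

subsection \<open>Entropies of even log-concave densities\<close>

context even_log_concave
begin

definition profile_mean :: "real \<Rightarrow> real" where
  "profile_mean q = (\<integral>u. profile (u / q) \<partial>exp_dist)"

definition power_integral :: "real \<Rightarrow> real" where
  "power_integral q = (\<integral>y. F y powr q \<partial>lborel)"

lemma power_integral_eq: "0 < q \<Longrightarrow> power_integral q = 2 * F 0 powr q * profile_mean q"
  unfolding power_integral_def profile_mean_def
  by (rule has_bochner_integral_integral_eq[OF has_bochner_integral_powr])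

lemma integrable_powr: "0 < q \<Longrightarrow> integrable lborel (\<lambda>y. F y powr q)"
  using has_bochner_integral_powr by (rule integrable.intros)

lemma has_bochner_integral_F: "has_bochner_integral lborel F 1"
  using F_total F_nonneg by (intro has_bochner_integral_nn_integral) auto

lemma power_integral_one: "power_integral 1 = 1"
  unfolding power_integral_def using has_bochner_integral_integral_eq[OF has_bochner_integral_F] F_nonneg by simp

lemma profile_mean_one: "2 * F 0 * profile_mean 1 = 1"
  using power_integral_one power_integral_eq[of 1] F_zero_pos by simp

lemma integrable_profile: "0 < q \<Longrightarrow> integrable exp_dist (\<lambda>u. profile (u / q))"
  by (rule profile.integrable_exp_dist_profile)

lemma profile_mean_mono: "0 < q \<Longrightarrow> q \<le> q' \<Longrightarrow> profile_mean q' \<le> profile_mean q"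
  unfolding profile_mean_def
proof (rule integral_mono_AE)
  assume q: "0 < q" "q \<le> q'"
  show "AE u in exp_dist. profile (u / q') \<le> profile (u / q)"
    using AE_exp_dist_pos by eventually_elim (use q in \<open>auto intro!: monoD[OF profile.mono] divide_left_mono\<close>)
qed (auto intro: integrable_profile)

text \<open>The perspective \<open>q profile (u/q)\<close> of the concave profile is concave in \<open>q\<close>.\<close>

lemma scaled_profile_mean_concave:
  assumes "0 < a" "0 < b" "0 \<le> s" "0 \<le> t" "s + t = 1"
  shows "s * (a * profile_mean a) + t * (b * profile_mean b) \<le> (s * a + t * b) * profile_mean (s * a + t * b)"
proof -
  let ?c = "s * a + t * b"
  have c: "0 < ?c"
  proof (cases "s = 0")
    case True then show ?thesis using assms by simp
  next
    case False then show ?thesis using assms by (intro add_pos_nonneg) auto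
  qed
  have "(\<integral>u. s * a * profile (u / a) + t * b * profile (u / b) \<partial>exp_dist) \<le> (\<integral>u. ?c * profile (u / ?c) \<partial>exp_dist)"
  proof (rule integral_mono_AE)
    show "AE u in exp_dist. s * a * profile (u / a) + t * b * profile (u / b) \<le> ?c * profile (u / ?c)"
      using AE_exp_dist_pos
    proof eventually_elim
      case (elim u)
      have w: "0 \<le> s * a / ?c" "0 \<le> t * b / ?c" "s * a / ?c + t * b / ?c = 1"
        using assms c by (auto simp flip: add_divide_distrib)
      have "s * a / ?c * profile (u / a) + t * b / ?c * profile (u / b)
          \<le> profile ((s * a / ?c) *\<^sub>R (u / a) + (t * b / ?c) *\<^sub>R (u / b))"
        by (rule concave_on_iff[THEN iffD1, OF profile.concave, THEN conjunct2, rule_format])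
           (use w elim assms in auto)
      also have "(s * a / ?c) *\<^sub>R (u / a) + (t * b / ?c) *\<^sub>R (u / b) = s * (u / ?c) + t * (u / ?c)"
        using assms by simp
      also have "\<dots> = (s + t) * (u / ?c)" by (simp only: distrib_right)
      finally have "s * a / ?c * profile (u / a) + t * b / ?c * profile (u / b) \<le> profile (u / ?c)"
        using assms by simp
      then have "?c * (s * a / ?c * profile (u / a) + t * b / ?c * profile (u / b)) \<le> ?c * profile (u / ?c)"
        using c by (intro mult_left_mono) auto
      then show ?case using c by (simp add: distrib_left)
    qed
  qed (use assms c in \<open>auto intro!: integrable_profile\<close>)
  then show ?thesis
    using assms c by (simp add: profile_mean_def integrable_profile mult.assoc)
qed

lemma profile_mean_scale:
  assumes "1 \<le> q"
  shows "profile_mean 1 \<le> q * profile_mean q"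
proof -
  have "(\<integral>u. 1 / q * profile u \<partial>exp_dist) \<le> (\<integral>u. profile (u / q) \<partial>exp_dist)"
  proof (rule integral_mono_AE)
    show "AE u in exp_dist. 1 / q * profile u \<le> profile (u / q)"
      using AE_exp_dist_pos
    proof eventually_elim
      case (elim u)
      then show ?case using profile.star[of "1/q" u] assms by simp
    qed
  qed (use assms integrable_profile[of q] integrable_profile[of 1] in auto)
  then show ?thesis using assms by (simp add: profile_mean_def field_simps)
qed

lemma profile_mean_pos: "0 < q \<Longrightarrow> 0 < profile_mean q"
proof -
  assume q: "0 < q"
  have "0 < 2 * F 0 * profile_mean 1" by (simp add: profile_mean_one)
  then have 1: "0 < profile_mean 1" using F_zero_pos by (simp add: zero_less_mult_iff)
  show ?thesis
  proof (cases "q \<le> 1")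
    case True
    then show ?thesis using profile_mean_mono[of q 1] 1 q by simp
  next
    case False
    then have "0 < q * profile_mean q" using profile_mean_scale[of q] 1 by simp
    then show ?thesis using q by (simp add: zero_less_mult_iff)
  qed
qed

lemma power_integral_pos: "0 < q \<Longrightarrow> 0 < power_integral q"
  using power_integral_eq[of q] profile_mean_pos[of q] F_zero_pos by simp

definition entropy :: "real \<Rightarrow> real" where
  "entropy \<alpha> = 1 / (1 - \<alpha>) * ln (power_integral \<alpha>)"

definition second_moment :: real where
  "second_moment = (\<integral>y. y^2 * F y \<partial>lborel)"

text \<open>Hoelder's inequality, obtained by integrating the weighted Young inequality for F^a and
  F^b normalised to integral 1.\<close>

lemma ln_power_integral_convex:
  assumes "0 < a" "0 < b" "0 < s" "0 < t" "s + t = 1"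
  shows "ln (power_integral (s * a + t * b)) \<le> s * ln (power_integral a) + t * ln (power_integral b)"
proof -
  let ?c = "s * a + t * b"
  define A B where "A = power_integral a" and "B = power_integral b"
  have c: "0 < ?c" using assms by (intro add_pos_pos) auto
  have pos: "0 < A" "0 < B" "0 < power_integral ?c"
    using power_integral_pos assms c by (auto simp: A_def B_def)
  have "power_integral ?c \<le> (\<integral>y. (A powr s * B powr t) * (s * (F y powr a / A) + t * (F y powr b / B)) \<partial>lborel)"
    unfolding power_integral_def
  proof (rule integral_mono)
    fix y
    show "F y powr ?c \<le> (A powr s * B powr t) * (s * (F y powr a / A) + t * (F y powr b / B))"
    proof (cases "F y = 0")
      case True
      then show ?thesis using assms by simp
    next
      case False
      then have F: "0 < F y" using F_nonneg[of y] by simp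
      have "(F y powr a / A) powr s * (F y powr b / B) powr t \<le> s * (F y powr a / A) + t * (F y powr b / B)"
        using assms pos F by (intro Youngs_inequality_0) auto
      then have "(A powr s * B powr t) * ((F y powr a / A) powr s * (F y powr b / B) powr t)
          \<le> (A powr s * B powr t) * (s * (F y powr a / A) + t * (F y powr b / B))"
        by (intro mult_left_mono) auto
      moreover have "(A powr s * B powr t) * ((F y powr a / A) powr s * (F y powr b / B) powr t) = F y powr ?c"
        using pos F by (simp add: powr_divide powr_powr powr_add mult.commute)
      ultimately show ?thesis by simp
    qed
  next
    show "integrable lborel (\<lambda>y. F y powr ?c)" using c by (rule integrable_powr)
    show "integrable lborel (\<lambda>y. (A powr s * B powr t) * (s * (F y powr a / A) + t * (F y powr b / B)))"
      using assms by (intro integrable_mult_right Bochner_Integration.integrable_add integrable_divide_zero integrable_powr)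
  qed
  also have "\<dots> = (A powr s * B powr t) * (s * (A / A) + t * (B / B))"
    using assms by (simp add: integrable_powr A_def B_def power_integral_def)
  also have "\<dots> = A powr s * B powr t" using pos assms by simp
  finally have "ln (power_integral ?c) \<le> ln (A powr s * B powr t)" using pos by simp
  then show ?thesis using pos by (simp add: ln_mult ln_powr A_def B_def)
qed

text \<open>The entropy is minus the slope of the chord of ln power_integral from order 1, where
  that convex function vanishes. The cases differ in whether 1 lies between the two orders or below
  both.\<close>

lemma entropy_antimono:
  assumes "0 < \<alpha>" "\<alpha> < p" "\<alpha> \<noteq> 1" "1 < p"
  shows "entropy p \<le> entropy \<alpha>"
proof (cases "\<alpha> < 1")
  case True
  have "ln (power_integral ((p - 1) / (p - \<alpha>) * \<alpha> + (1 - \<alpha>) / (p - \<alpha>) * p))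
      \<le> (p - 1) / (p - \<alpha>) * ln (power_integral \<alpha>) + (1 - \<alpha>) / (p - \<alpha>) * ln (power_integral p)"
    using assms True by (intro ln_power_integral_convex) (auto simp flip: add_divide_distrib)
  moreover have "(p - 1) / (p - \<alpha>) * \<alpha> + (1 - \<alpha>) / (p - \<alpha>) * p = 1"
    using assms by (simp add: field_simps flip: add_divide_distrib)
  ultimately have "0 \<le> (p - 1) / (p - \<alpha>) * ln (power_integral \<alpha>) + (1 - \<alpha>) / (p - \<alpha>) * ln (power_integral p)"
    by (simp add: power_integral_one)
  then have "0 \<le> ((p - 1) * ln (power_integral \<alpha>) + (1 - \<alpha>) * ln (power_integral p)) / (p - \<alpha>)"
    by (simp add: add_divide_distrib)
  then have "0 \<le> (p - 1) * ln (power_integral \<alpha>) + (1 - \<alpha>) * ln (power_integral p)"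
    using assms by (simp add: zero_le_divide_iff)
  then show ?thesis using assms True by (simp add: entropy_def divide_simps) (simp add: algebra_simps)
next
  case False
  have "ln (power_integral ((p - \<alpha>) / (p - 1) * 1 + (\<alpha> - 1) / (p - 1) * p))
      \<le> (p - \<alpha>) / (p - 1) * ln (power_integral 1) + (\<alpha> - 1) / (p - 1) * ln (power_integral p)"
    using assms False by (intro ln_power_integral_convex) (auto simp flip: add_divide_distrib)
  moreover have "(p - \<alpha>) / (p - 1) * 1 + (\<alpha> - 1) / (p - 1) * p = \<alpha>"
    using assms by (simp add: divide_simps) (simp add: algebra_simps)
  ultimately have "ln (power_integral \<alpha>) \<le> (\<alpha> - 1) / (p - 1) * ln (power_integral p)"
    by (simp add: power_integral_one)
  then show ?thesis using assms False by (simp add: entropy_def divide_simps) (simp add: algebra_simps)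
qed

text \<open>\<open>J\<close> vanishes at 1, and the shifted entropy at q is minus its chord slope J
  q / (q - 1). \<open>J\<close> is concave: apart from terms affine in q it is the logarithm of q *
  profile_mean q, which is concave in q.\<close>

lemma shifted_entropy_mono:
  assumes "1 < p" "p < \<alpha>"
  shows "entropy p - ln p / (p - 1) \<le> entropy \<alpha> - ln \<alpha> / (\<alpha> - 1)"
proof -
  define s t where "s = (\<alpha> - p) / (\<alpha> - 1)" and "t = (p - 1) / (\<alpha> - 1)"
  have st: "0 < s" "0 < t" "s + t = 1"
    using assms by (auto simp: s_def t_def simp flip: add_divide_distrib)
  have "s * 1 + t * \<alpha> = ((\<alpha> - p) + (p - 1) * \<alpha>) / (\<alpha> - 1)"
    by (simp add: s_def t_def add_divide_distrib)
  also have "(\<alpha> - p) + (p - 1) * \<alpha> = p * (\<alpha> - 1)" by (simp add: algebra_simps)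
  finally have st: "0 < s" "0 < t" "s + t = 1" "s * 1 + t * \<alpha> = p" using st assms by simp_all
  define J where "J q = ln (q * power_integral q)" for q
  have pm: "0 < profile_mean 1" "0 < profile_mean \<alpha>" "0 < profile_mean p"
    using profile_mean_pos assms by auto
  have "profile_mean 1 powr s * (\<alpha> * profile_mean \<alpha>) powr t \<le> s * profile_mean 1 + t * (\<alpha> * profile_mean \<alpha>)"
    using st pm assms by (intro Youngs_inequality_0) auto
  also have "\<dots> \<le> p * profile_mean p"
    using scaled_profile_mean_concave[of 1 \<alpha> s t] st assms by simp
  finally have "ln (profile_mean 1 powr s * (\<alpha> * profile_mean \<alpha>) powr t) \<le> ln (p * profile_mean p)"
    using pm assms by simp
  then have le: "s * ln (profile_mean 1) + t * ln (\<alpha> * profile_mean \<alpha>) \<le> ln (p * profile_mean p)"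
    using pm assms by (simp add: ln_mult ln_powr)
  have J: "J q = ln (2::real) + q * ln (F 0) + ln (q * profile_mean q)" if "0 < q" for q
    using that power_integral_eq[OF that] profile_mean_pos[OF that] F_zero_pos
    by (simp add: J_def ln_mult ln_powr)
  have "s * J 1 + t * J \<alpha> = (s + t) * ln 2 + (s * 1 + t * \<alpha>) * ln (F 0) + (s * ln (profile_mean 1) + t * ln (\<alpha> * profile_mean \<alpha>))"
    using assms by (simp add: J algebra_simps)
  also have "\<dots> = ln 2 + p * ln (F 0) + (s * ln (profile_mean 1) + t * ln (\<alpha> * profile_mean \<alpha>))"
    by (simp only: st mult_1)
  also have "\<dots> \<le> J p" using le assms by (simp add: J)
  finally have "t * J \<alpha> \<le> J p" by (simp add: J_def power_integral_one)
  then have "J \<alpha> / (\<alpha> - 1) \<le> J p / (p - 1)"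
    using assms by (simp add: t_def field_simps)
  moreover have "entropy q - ln q / (q - 1) = - (J q / (q - 1))" if "1 < q" for q
    using that power_integral_pos[of q]
    by (simp add: entropy_def J_def ln_mult divide_simps) (simp add: algebra_simps)
  ultimately show ?thesis using assms by simp
qed

section \<open>The bound at the critical order and its equality cases\<close>

lemma second_moment_eq: "second_moment = 2/3 * F 0 * (\<integral>u. profile u ^ 3 \<partial>exp_dist)"
  unfolding second_moment_def by (rule has_bochner_integral_integral_eq[OF has_bochner_integral_square])

lemma critical_entropy_bound:
  assumes "near_critical p" and crit: "(p - 1) / 2 * ln 6 = ln p"
  shows "1/2 * ln second_moment + 1/2 * ln 12 \<le> entropy p"
    and "entropy p = 1/2 * ln second_moment + 1/2 * ln 12 \<Longrightarrow>
      profile_mean p = profile_mean 1 \<or> p * profile_mean p = profile_mean 1"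
proof -
  interpret near_critical p by fact
  define A C B where "A = profile_mean 1" and "C = profile_mean p" and "B = (\<integral>u. profile u ^ 3 \<partial>exp_dist)"
  define K where "K = p / (p - 1) * (A - C)"
  \<comment> \<open>\<open>profile_mean_mono\<close> and \<open>profile_mean_scale\<close> give 0
    \<le> K \<le> A, so r lies in [0, 1], with the uniform law at 0 and the exponential one at
    1.\<close>
  define r where "r = K / A"
  define \<theta> where "\<theta> = (p - 1) / 2"
  have p1: "1 < p" "p < 4/3" using p by auto
  have A: "0 < A" "0 < C" using profile_mean_pos p1 by (auto simp: A_def C_def)
  have CA: "C \<le> A" "A \<le> p * C"
    using profile_mean_mono[of 1 p] profile_mean_scale[of p] p1 by (auto simp: A_def C_def)
  have r0: "0 \<le> r" using A CA p1 by (simp add: r_def K_def)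
  have "K \<le> A" using CA p1 by (simp add: K_def field_simps)
  then have r1: "r \<le> 1" using A by (simp add: r_def)
  have C_eq: "C = A * (1 - (1 - 1/p) * r)"
    using A p1 by (simp add: r_def K_def field_simps)
  have "B \<le> A^3 + 3/2 * A^2 * K + 7/2 * K^3"
    using third_moment_bound[OF profile.concave_profile_axioms]
    by (simp add: A_def B_def C_def K_def profile_mean_def)
  also have "\<dots> = A^3 * (1 + 3/2 * r + 7/2 * r^3)"
    using A by (simp add: r_def power_numeral_reduce field_simps)
  finally have B: "B \<le> A^3 * (1 + 3/2 * r + 7/2 * r^3)" .
  have M: "0 < F 0" by (rule F_zero_pos)
  have MA: "F 0 = 1 / (2 * A)" using profile_mean_one A by (simp add: A_def field_simps)
  have B0: "0 < B"
  proof -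
    have int: "integrable exp_dist (\<lambda>u. profile u ^ 3)" by (rule profile.integrable_exp_dist_profile)
    have "B \<noteq> 0"
    proof
      assume "B = 0"
      then have "AE u in exp_dist. profile u ^ 3 = 0"
        using integral_nonneg_eq_0_iff_AE[OF int] profile.nonneg by (simp add: B_def)
      then have "A = (\<integral>u. 0 \<partial>exp_dist)"
        unfolding A_def profile_mean_def by (intro integral_cong_AE) auto
      then show False using A by simp
    qed
    moreover have "0 \<le> B" unfolding B_def using profile.nonneg by (intro integral_nonneg_AE) auto
    ultimately show ?thesis by simp
  qed
  have poly: "0 < 1 + 3/2 * r + 7/2 * r^3" using r0 by (intro add_pos_nonneg) auto
  have lin: "0 < 1 - (1 - 1/p) * r" using C_eq A by (simp add: zero_less_mult_iff)
  have lnB: "ln B \<le> 3 * ln A + ln (1 + 3/2 * r + 7/2 * r^3)"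
  proof -
    have "ln B \<le> ln (A^3 * (1 + 3/2 * r + 7/2 * r^3))" using B B0 by simp
    then show ?thesis using A poly by (simp add: ln_mult ln_realpow)
  qed
  have lnC: "ln C = ln A + ln (1 - (1 - 1/p) * r)" using A lin by (simp add: C_eq ln_mult)
  \<comment> \<open>As F 0 = 1 / (2 A), both sides depend only on A, B and C. The factor p - 1
    clears the denominator of the entropy, and the resulting combination is invariant under scaling
    of the profile.\<close>
  have gap: "(p - 1) * (entropy p - (1/2 * ln second_moment + 1/2 * ln 12)) = (1 + 3 * \<theta>) * ln A - ln C - \<theta> * ln B"
  proof -
    have "ln (power_integral p) = ln 2 + p * ln (1 / (2 * A)) + ln C"
      using power_integral_eq[of p] p1 A by (simp add: MA C_def ln_mult ln_powr)
    also have "\<dots> = (1 - p) * ln 2 - p * ln A + ln C" using A by (simp add: ln_div ln_mult algebra_simps)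
    finally have 1: "ln (power_integral p) = (1 - p) * ln 2 - p * ln A + ln C" .
    have "entropy p * (1 - p) = ln (power_integral p)" using p1 by (simp add: entropy_def)
    then have e: "(p - 1) * entropy p = - ln (power_integral p)" by (simp add: algebra_simps)
    have "second_moment = B / (3 * A)" using A by (simp add: second_moment_eq MA B_def)
    then have s: "0 < second_moment" "second_moment * 12 = 2 * 2 * (B / A)" using A B0 by simp_all
    have "ln second_moment + ln 12 = ln (second_moment * 12)" using s(1) by (simp add: ln_mult)
    also have "\<dots> = ln (2 * 2 * (B / A))" by (simp only: s(2))
    also have "\<dots> = 2 * ln 2 + ln B - ln A" using A B0 by (simp only: ln_mult ln_div) (simp add: ln_mult ln_div)
    finally have 2: "ln second_moment + ln 12 = 2 * ln 2 + ln B - ln A" .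
    have "(p - 1) * (entropy p - (1/2 * ln second_moment + 1/2 * ln 12))
        = (p - 1) * entropy p - \<theta> * (ln second_moment + ln 12)"
      by (simp add: \<theta>_def field_simps)
    also have "\<dots> = (1 + 3 * \<theta>) * ln A - ln C - \<theta> * ln B"
      unfolding e 1 2 by (simp add: \<theta>_def field_simps)
    finally show ?thesis .
  qed
  have "\<theta> * ln B \<le> \<theta> * (3 * ln A + ln (1 + 3/2 * r + 7/2 * r^3))"
    using lnB p1 by (intro mult_left_mono) (auto simp: \<theta>_def)
  then have low: "- ln (1 - (1 - 1/p) * r) - \<theta> * ln (1 + 3/2 * r + 7/2 * r^3)
      \<le> (p - 1) * (entropy p - (1/2 * ln second_moment + 1/2 * ln 12))"
    unfolding gap lnC by (simp add: algebra_simps)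
  have strict: "0 < (p - 1) * (entropy p - (1/2 * ln second_moment + 1/2 * ln 12))" if "r \<noteq> 0" "r \<noteq> 1"
    using log_cubic_less[OF p1 crit, of r] that r0 r1 low by (simp add: \<theta>_def)
  have "0 \<le> (p - 1) * (entropy p - (1/2 * ln second_moment + 1/2 * ln 12))"
  proof -
    consider "r = 0" | "r = 1" | "r \<noteq> 0" "r \<noteq> 1" by blast
    then show ?thesis
    proof cases
      case 2
      then have "- ln (1 - (1 - 1/p) * r) - \<theta> * ln (1 + 3/2 * r + 7/2 * r^3) = 0"
        using crit p1 by (simp add: \<theta>_def ln_div)
      then show ?thesis using low by linarith
    qed (use low strict in auto)
  qed
  then show "1/2 * ln second_moment + 1/2 * ln 12 \<le> entropy p" using p1 by (simp add: zero_le_mult_iff)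
  show "profile_mean p = profile_mean 1 \<or> p * profile_mean p = profile_mean 1"
    if "entropy p = 1/2 * ln second_moment + 1/2 * ln 12"
  proof -
    have "r = 0 \<or> r = 1" using strict that by auto
    then show ?thesis
    proof
      assume "r = 0"
      then have "C = A" using C_eq by simp
      then show ?thesis by (simp add: A_def C_def)
    next
      assume "r = 1"
      then have "p * C = A" using C_eq p1 by (simp add: field_simps)
      then show ?thesis by (simp add: A_def C_def)
    qed
  qed
qed

text \<open>The hypothesis says that the pointwise bound F^p \<le> F(0)^(p-1) F has equal integrals
  on both sides. Hence F takes only the values 0 and F 0 almost everywhere.\<close>

lemma uniform_of_profile_mean_eq:
  assumes "1 < p" "profile_mean p = profile_mean 1"
  obtains L where "0 < L" "AE y in lborel. F y = indicator {- L..L} y / (2 * L)"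
proof -
  define M where "M = F 0"
  have M: "0 < M" "F y \<le> M" for y using F_zero_pos F_le_zero by (auto simp: M_def)
  have p0: "0 < p" using assms by simp
  have int: "integrable lborel (\<lambda>y. M powr (p - 1) * F y - F y powr p)"
    using integrable_powr[OF p0] has_bochner_integral_F by (auto simp: has_bochner_integral_iff)
  have nn: "0 \<le> M powr (p - 1) * F y - F y powr p" for y
  proof -
    have "F y powr p = F y powr (p - 1) * F y"
      using F_nonneg[of y] by (cases "F y = 0") (auto simp: powr_diff)
    also have "\<dots> \<le> M powr (p - 1) * F y"
      using assms M F_nonneg by (intro mult_right_mono powr_mono2) auto
    finally show ?thesis by simp
  qed
  have "power_integral p = M powr (p - 1)"
  proof -
    have "power_integral p = M powr (p - 1) * (2 * M * profile_mean 1)"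
      using power_integral_eq[OF p0] assms M by (simp add: M_def powr_diff)
    then show ?thesis using profile_mean_one by (simp add: M_def)
  qed
  then have "(\<integral>y. M powr (p - 1) * F y - F y powr p \<partial>lborel) = 0"
    using integrable_powr[OF p0] has_bochner_integral_F
    by (simp add: has_bochner_integral_iff power_integral_def)
  then have "AE y in lborel. M powr (p - 1) * F y - F y powr p = 0"
    using integral_nonneg_eq_0_iff_AE[OF int] nn by simp
  then have two: "AE y in lborel. F y = 0 \<or> F y = M"
  proof eventually_elim
    case (elim y)
    show ?case
    proof (rule ccontr)
      assume "\<not> ?case"
      then have y: "0 < F y" "F y < M" using F_nonneg[of y] M(2)[of y] by auto
      then have "F y powr (p - 1) * F y < M powr (p - 1) * F y"
        using assms by (intro mult_strict_right_mono powr_less_mono2) auto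
      then show False using elim y by (simp add: powr_diff)
    qed
  qed
  \<comment> \<open>For a two-valued F any level strictly between 0 and F 0 picks out the support; F
    0 * exp (- 1) is one such level.\<close>
  define L where "L = profile 1"
  have "AE y in lborel. y \<noteq> L" "AE y in lborel. y \<noteq> - L" by (rule AE_lborel_singleton)+
  with two have F_ind: "AE y in lborel. F y = M * indicator {- L..L} y"
  proof eventually_elim
    case (elim y)
    then have "\<bar>y\<bar> < L \<or> L < \<bar>y\<bar>" by linarith
    then show ?case
    proof
      assume y: "\<bar>y\<bar> < L"
      then have "M * exp (- 1) < F y" using profile_lower[of y 1] by (simp add: L_def M_def)
      moreover have "0 < M * exp (- 1)" using M by simp
      ultimately have "F y \<noteq> 0" by linarith
      moreover have "y \<in> {- L..L}" using y by auto
      ultimately show ?thesis using elim by simp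
    next
      assume y: "L < \<bar>y\<bar>"
      then have "\<not> M * exp (- 1) < F y" using profile_upper[of 1 y] by (auto simp: L_def M_def)
      moreover have "M * exp (- 1) < M" using M by simp
      ultimately have "F y \<noteq> M" by auto
      moreover have "y \<notin> {- L..L}" using y by auto
      ultimately show ?thesis using elim by simp
    qed
  qed
  have L0: "0 \<le> L" using profile.nonneg by (simp add: L_def)
  have "1 = (\<integral>y. F y \<partial>lborel)" using has_bochner_integral_F by (simp add: has_bochner_integral_iff)
  also have "\<dots> = (\<integral>y. M * indicator {- L..L} y \<partial>lborel)"
    using F_ind by (intro integral_cong_AE) auto
  also have "\<dots> = M * (2 * L)" using L0 by simp
  finally have LM: "M * (2 * L) = 1" by simp
  then have L: "0 < L" using L0 by (cases "L = 0") auto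
  have "M = 1 / (2 * L)" using LM L by (simp add: field_simps)
  with F_ind have "AE y in lborel. F y = indicator {- L..L} y / (2 * L)" by simp
  with L show thesis by (rule that)
qed

text \<open>Equality of the means forces p * profile (u / p) = profile u. Iterating this carries the
  ratio profile u / u towards 0; as the ratio is also nonincreasing, it is constant. A linear
  profile belongs to an exponential density.\<close>

lemma exponential_of_profile_mean_eq:
  assumes "1 < p" "p * profile_mean p = profile_mean 1"
  obtains l where "0 < l" "AE y in lborel. F y = l / 2 * exp (- l * \<bar>y\<bar>)"
proof -
  have p0: "0 < p" using assms by simp
  have int: "integrable exp_dist (\<lambda>u. p * profile (u / p) - profile u)"
    using integrable_profile[OF p0] integrable_profile[of 1] by auto
  have star: "profile u \<le> p * profile (u / p)" if "0 \<le> u" for u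
    using profile.star[of "1/p" u] assms that by (simp add: field_simps)
  have "(\<integral>u. p * profile (u / p) - profile u \<partial>exp_dist) = 0"
    using assms integrable_profile[OF p0] integrable_profile[of 1] by (simp add: profile_mean_def)
  moreover have "AE u in exp_dist. 0 \<le> p * profile (u / p) - profile u"
    using AE_exp_dist_pos by eventually_elim (use star in auto)
  ultimately have "AE u in exp_dist. p * profile (u / p) - profile u = 0"
    using integral_nonneg_eq_0_iff_AE[OF int] by simp
  then have ae: "AE u in lborel. 0 < u \<longrightarrow> p * profile (u / p) - profile u = 0"
    unfolding exp_dist_def by (subst (asm) AE_density) (auto simp: exponential_density_def elim: eventually_mono)
  \<comment> \<open>Continuity upgrades the almost everywhere identity: a failure at u would persist
    on an interval of positive length.\<close>
  have eq: "p * profile (u / p) = profile u" if u: "0 < u" for u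
  proof (rule ccontr)
    let ?g = "\<lambda>u. p * profile (u / p) - profile u"
    assume "p * profile (u / p) \<noteq> profile u"
    then have "?g u \<noteq> 0" by simp
    moreover have "isCont ?g u"
      using profile.isCont_profile[OF u] profile.isCont_profile[of "u / p"] u p0
      by (auto intro!: continuous_intros isCont_o2[of u "\<lambda>u. u / p" profile])
    ultimately have "eventually (\<lambda>v. ?g v \<noteq> 0) (at u)"
      unfolding isCont_def by (rule tendsto_imp_eventually_ne[rotated])
    then obtain d where d: "0 < d" "\<And>v. v \<noteq> u \<Longrightarrow> dist v u < d \<Longrightarrow> ?g v \<noteq> 0"
      unfolding eventually_at by auto
    have "AE v in lborel. v \<notin> {u<..<u + d}"
      using ae
    proof eventually_elim
      case (elim v)
      show ?case
      proof
        assume v: "v \<in> {u<..<u + d}"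
        then have "?g v \<noteq> 0" using d(2)[of v] by (auto simp: dist_real_def)
        then show False using elim v u by auto
      qed
    qed
    then have "emeasure lborel {v \<in> space lborel. v \<in> {u<..<u + d}} = 0" by (rule emeasure_eq_0_AE)
    moreover have "{v \<in> space lborel. v \<in> {u<..<u + d}} = {u<..<u + d}" by auto
    ultimately show False using d by simp
  qed
  have iter: "p ^ n * profile (u / p ^ n) = profile u" if "0 < u" for u n
  proof (induction n)
    case (Suc n)
    have "p * profile ((u / p ^ n) / p) = profile (u / p ^ n)" using that p0 by (intro eq) simp
    then have "p ^ n * (p * profile (u / p ^ n / p)) = p ^ n * profile (u / p ^ n)" by simp
    then show ?case using Suc by (simp add: mult_ac)
  qed simp
  have ratio: "profile b / b \<le> profile a / a" if "0 < a" "a \<le> b" for a b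
  proof -
    have "a / b * profile b \<le> profile (a / b * b)" using that by (intro profile.star) auto
    then show ?thesis using that by (simp add: field_simps)
  qed
  define c where "c = profile 1"
  have lin: "profile u = c * u" if u: "0 < u" for u
  proof -
    have same: "profile a / a = profile b / b" if "0 < a" "a \<le> b" for a b
    proof -
      \<comment> \<open>Dividing b by a large power of p brings it below a without changing its
        ratio, so the ratio at a is squeezed between two equal values.\<close>
      obtain n where "b / a < p ^ n" using real_arch_pow[OF assms(1)] by blast
      then have n: "b / p ^ n \<le> a" using that p0 by (simp add: field_simps)
      have "profile a / a \<le> profile (b / p ^ n) / (b / p ^ n)"
        using n that p0 by (intro ratio) auto
      also have "\<dots> = profile b / b" using iter[of b n] that p0 by (simp add: field_simps)
      finally show ?thesis using ratio[OF that] by simp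
    qed
    have "profile u / u = profile 1 / 1"
      using same[of u 1] same[of 1 u] u by (cases "u \<le> 1") auto
    then show ?thesis using u by (simp add: c_def field_simps)
  qed
  have "c \<noteq> 0"
  proof
    assume "c = 0"
    then have "profile u = 0" for u using lin[of u] profile.zero[of u] by (cases "0 < u") auto
    then show False using profile_mean_one by (simp add: profile_mean_def)
  qed
  then have c: "0 < c" using profile.nonneg[of 1] by (simp add: c_def)
  \<comment> \<open>At y the level |y| / c is the critical one: higher u put y inside the superlevel
    set, lower u leave it outside, and this pins down ln (F y).\<close>
  have F_eq: "F y = F 0 * exp (- (1 / c) * \<bar>y\<bar>)" if y: "y \<noteq> 0" for y
  proof -
    define w where "w = \<bar>y\<bar> / c"
    have w: "0 < w" "\<bar>y\<bar> = c * w" using y c by (auto simp: w_def)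
    have above: "F 0 * exp (- u) < F y" if "w < u" for u
      using profile_lower[of y u] lin[of u] that w c by simp
    have below: "F y \<le> F 0 * exp (- u)" if "0 < u" "u < w" for u
      using profile_upper[of u y] lin[of u] that w c by fastforce
    have Fy: "0 < F y" using above[of "w + 1"] F_zero_pos by (meson exp_gt_zero less_add_one less_trans mult_pos_pos)
    define z where "z = ln (F 0) - ln (F y)"
    have z1: "z \<le> u" if "w < u" for u
    proof -
      have "ln (F 0 * exp (- u)) < ln (F y)" using above[OF that] Fy F_zero_pos by simp
      then show ?thesis using F_zero_pos by (simp add: z_def ln_mult)
    qed
    have z2: "u \<le> z" if "0 < u" "u < w" for u
    proof -
      have "ln (F y) \<le> ln (F 0 * exp (- u))" using below[OF that] Fy F_zero_pos by simp
      then show ?thesis using F_zero_pos by (simp add: z_def ln_mult)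
    qed
    have "z = w" using dense_ge[of w z] dense_le_bounded[of 0 w z] z1 z2 w by force
    then have "ln (F y) = ln (F 0 * exp (- w))" using F_zero_pos by (simp add: z_def ln_mult)
    then have "F y = F 0 * exp (- w)" using Fy F_zero_pos by simp
    then show ?thesis by (simp add: w_def)
  qed
  have "profile_mean 1 = (\<integral>u. c * u \<partial>exp_dist)"
    unfolding profile_mean_def using AE_exp_dist_pos lin by (intro integral_cong_AE) (auto elim: eventually_mono)
  also have "\<dots> = c" using integral_exp_dist_power[of 1] by simp
  finally have "F 0 = (1 / c) / 2" using profile_mean_one c by (simp add: field_simps)
  moreover have "AE y in lborel. y \<noteq> (0::real)" by (rule AE_lborel_singleton)
  then have "AE y in lborel. F y = F 0 * exp (- (1 / c) * \<bar>y\<bar>)"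
    by eventually_elim (rule F_eq)
  ultimately show thesis using that[of "1 / c"] c by simp
qed

end

subsection \<open>The extremal laws and the main theorem\<close>

lemma renyi_entropy_real_density:
  assumes "distributed M lborel X (\<lambda>x. ennreal (f x))" "\<And>x. 0 \<le> f x"
  shows "renyi_entropy \<alpha> M X = 1 / (1 - \<alpha>) * ln (LINT x|lborel. f x powr \<alpha>)"
  using renyi_entropy_eq_density[OF assms(1), of \<alpha>] assms(2) by simp

lemma symmetric_rv_expectation:
  assumes [measurable]: "X \<in> borel_measurable M" and "symmetric_rv M X"
  shows "(LINT \<omega>|M. X \<omega>) = 0"
proof -
  have "(LINT \<omega>|M. X \<omega>) = (LINT x|distr M lborel X. x)" by (simp add: integral_distr)
  also have "\<dots> = (LINT x|distr M lborel (\<lambda>\<omega>. - X \<omega>). x)"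
    using assms(2) by (simp add: symmetric_rv_def)
  also have "\<dots> = - (LINT \<omega>|M. X \<omega>)" by (simp add: integral_distr)
  finally show ?thesis by simp
qed

lemma symmetric_rv_variance:
  assumes "prob_space M" "X \<in> borel_measurable M" "symmetric_rv M X"
    and "distributed M lborel X (\<lambda>x. ennreal (f x))" "\<And>x. 0 \<le> f x"
  shows "prob_space.variance M X = (LINT x|lborel. x^2 * f x)"
proof -
  interpret prob_space M by fact
  have "variance X = (LINT \<omega>|M. (X \<omega>)^2)"
    using symmetric_rv_expectation[OF assms(2,3)] by simp
  also have "\<dots> = (LINT x|lborel. f x * x^2)"
    using assms(5) by (subst distributed_integral[OF assms(4)]) auto
  finally show ?thesis by (simp add: mult.commute)
qed

lemma uniform_symmetric_rv_iff:
  assumes "X \<in> borel_measurable M"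
  shows "uniform_symmetric_rv M X \<longleftrightarrow>
    (\<exists>L>0. distributed M lborel X (\<lambda>x. ennreal (indicator {- L..L} x / (2 * L))))"
proof -
  have "uniform_measure lborel {- L..L} = density lborel (\<lambda>x. ennreal (indicator {- L..L} x / (2 * L)))"
    if "0 < L" for L :: real
    unfolding uniform_measure_def using that
    by (intro density_cong) (auto simp: indicator_def divide_ennreal simp flip: ennreal_1)
  then show ?thesis
    using assms unfolding uniform_symmetric_rv_def distributed_def by (auto cong: conj_cong)
qed

lemma uniform_moments:
  fixes L \<alpha> :: real
  assumes "0 < L" "0 < \<alpha>"
  shows "(LINT x|lborel. (indicator {- L..L} x / (2 * L)) powr \<alpha>) = (2 * L) powr (1 - \<alpha>)"
    and "(LINT x|lborel. x^2 * (indicator {- L..L} x / (2 * L))) = L^2 / 3"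
proof -
  have eq: "(indicator {- L..L} x / (2 * L)) powr \<alpha> = indicator {- L..L} x *\<^sub>R ((2 * L) powr (- \<alpha>))" for x
    using assms by (auto simp: indicator_def powr_divide powr_minus field_simps)
  show "(LINT x|lborel. (indicator {- L..L} x / (2 * L)) powr \<alpha>) = (2 * L) powr (1 - \<alpha>)"
    unfolding eq using assms by (simp add: powr_diff powr_minus field_simps)
  have "(LINT x|lborel. x^2 * (indicator {- L..L} x / (2 * L))) = (LINT x|lborel. x^2 * indicator {- L..L} x) / (2 * L)"
    by simp
  also have "\<dots> = L^2 / 3"
    using assms by (subst integral_power) (auto simp: power2_eq_square power3_eq_cube field_simps)
  finally show "(LINT x|lborel. x^2 * (indicator {- L..L} x / (2 * L))) = L^2 / 3" .
qed

text \<open>The half-line integral is a rescaled moment of the exponential law; evenness doubles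
  it.\<close>

lemma integral_even_power_exp_abs:
  fixes c :: real
  assumes "0 < c" "even k"
  shows "(LINT x|lborel. x^k * exp (- c * \<bar>x\<bar>)) = 2 * fact k / c ^ Suc k"
proof -
  have "has_bochner_integral lborel (\<lambda>u. exponential_density 1 u * u^k) (fact k)"
    using has_bochner_integral_exp_dist_power[of k] unfolding exp_dist_def has_bochner_integral_iff
    by (subst (asm) integrable_real_density, simp_all)
       (subst (asm) integral_real_density, simp_all)
  then have "has_bochner_integral lborel (\<lambda>u. exponential_density 1 (0 + c * u) * (0 + c * u)^k) (fact k /\<^sub>R \<bar>c\<bar>)"
    using assms lborel_has_bochner_integral_real_affine_iff[of c "\<lambda>u. exponential_density 1 u * u^k" "fact k" 0] by simp
  then have "has_bochner_integral lborel (\<lambda>u. exponential_density 1 (0 + c * u) * (0 + c * u)^k / c^k) (fact k /\<^sub>R \<bar>c\<bar> / c^k)"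
    by (rule has_bochner_integral_divide_zero)
  moreover have "exponential_density 1 (0 + c * u) * (0 + c * u)^k / c^k = indicator {0..} u *\<^sub>R (u^k * exp (- c * \<bar>u\<bar>))" for u
    using assms by (auto simp: exponential_density_def indicator_def power_mult_distrib mult_less_0_iff)
  ultimately have "has_bochner_integral lborel (\<lambda>u. indicator {0..} u *\<^sub>R (u^k * exp (- c * \<bar>u\<bar>))) (fact k /\<^sub>R \<bar>c\<bar> / c^k)"
    by simp
  then have "has_bochner_integral lborel (\<lambda>x. x^k * exp (- c * \<bar>x\<bar>)) (2 *\<^sub>R (fact k /\<^sub>R \<bar>c\<bar> / c^k))"
    using assms by (intro has_bochner_integral_even_function) auto
  then show ?thesis
    using assms by (auto dest!: has_bochner_integral_integral_eq simp: divide_inverse mult_ac)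
qed

lemma exponential_moments:
  fixes l \<alpha> :: real
  assumes "0 < l" "0 < \<alpha>"
  shows "(LINT x|lborel. (l / 2 * exp (- l * \<bar>x\<bar>)) powr \<alpha>) = (l / 2) powr (\<alpha> - 1) / \<alpha>"
    and "(LINT x|lborel. x^2 * (l / 2 * exp (- l * \<bar>x\<bar>))) = 2 / l^2"
proof -
  have "(l / 2 * exp (- l * \<bar>x\<bar>)) powr \<alpha> = (l / 2) powr \<alpha> * (x^0 * exp (- (\<alpha> * l) * \<bar>x\<bar>))" for x
  proof -
    have "(l / 2 * exp (- l * \<bar>x\<bar>)) powr \<alpha> = (l / 2) powr \<alpha> * exp (- l * \<bar>x\<bar>) powr \<alpha>"
      by (rule powr_mult)
    also have "exp (- l * \<bar>x\<bar>) powr \<alpha> = x^0 * exp (- (\<alpha> * l) * \<bar>x\<bar>)"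
      by (simp add: powr_def mult_ac)
    finally show ?thesis .
  qed
  then have "(LINT x|lborel. (l / 2 * exp (- l * \<bar>x\<bar>)) powr \<alpha>) = (l / 2) powr \<alpha> * (2 * fact 0 / (\<alpha> * l) ^ Suc 0)"
    using integral_even_power_exp_abs[of "\<alpha> * l" 0] assms by simp
  also have "\<dots> = (l / 2) powr (\<alpha> - 1) / \<alpha>" using assms by (simp add: powr_diff field_simps)
  finally show "(LINT x|lborel. (l / 2 * exp (- l * \<bar>x\<bar>)) powr \<alpha>) = (l / 2) powr (\<alpha> - 1) / \<alpha>" .
  have "(LINT x|lborel. x^2 * (l / 2 * exp (- l * \<bar>x\<bar>))) = (LINT x|lborel. l / 2 * (x^2 * exp (- l * \<bar>x\<bar>)))"
    by (simp add: mult_ac)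
  also have "\<dots> = l / 2 * (2 * fact 2 / l ^ Suc 2)"
    using integral_even_power_exp_abs[of l 2] assms by (simp del: power_Suc)
  also have "\<dots> = 2 / l^2" using assms by (simp add: power2_eq_square power3_eq_cube field_simps)
  finally show "(LINT x|lborel. x^2 * (l / 2 * exp (- l * \<bar>x\<bar>))) = 2 / l^2" .
qed

context
  fixes M :: "'a measure" and X :: "'a \<Rightarrow> real"
  assumes prob: "prob_space M" and X [measurable]: "X \<in> borel_measurable M" and sym: "symmetric_rv M X"
begin

lemma renyi_entropy_uniform:
  assumes "uniform_symmetric_rv M X" "0 < \<alpha>" "\<alpha> \<noteq> 1"
  shows "renyi_entropy \<alpha> M X = 1/2 * ln (prob_space.variance M X) + 1/2 * ln 12"
proof -
  obtain L where L: "0 < L" and D: "distributed M lborel X (\<lambda>x. ennreal (indicator {- L..L} x / (2 * L)))"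
    using assms uniform_symmetric_rv_iff[OF X] by auto
  have nn: "0 \<le> indicator {- L..L} x / (2 * L)" for x using L by simp
  have h: "renyi_entropy \<alpha> M X = ln (2 * L)"
    using renyi_entropy_real_density[OF D nn, of \<alpha>] uniform_moments(1)[OF L assms(2)] L assms by (simp add: ln_powr)
  have v: "prob_space.variance M X = L^2 / 3"
    using symmetric_rv_variance[OF prob X sym D nn] uniform_moments(2)[OF L assms(2)] by simp
  have "ln (L^2 / 3) + ln 12 = ln (L^2 / 3 * 12)" using L by (simp only: ln_mult) simp
  also have "L^2 / 3 * 12 = (2 * L)^2" by (simp add: power2_eq_square)
  also have "ln ((2 * L)^2) = 2 * ln (2 * L)" using L by (subst ln_realpow) auto
  finally have "1/2 * ln (L^2 / 3) + 1/2 * ln 12 = ln (2 * L)" by simp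
  then show ?thesis unfolding h v by simp
qed

lemma renyi_entropy_exponential:
  assumes "two_sided_exponential_rv M X" "0 < \<alpha>" "\<alpha> \<noteq> 1"
  shows "renyi_entropy \<alpha> M X = 1/2 * ln (prob_space.variance M X) + 1/2 * ln 2 + ln \<alpha> / (\<alpha> - 1)"
proof -
  obtain l where l: "0 < l" and D: "distributed M lborel X (\<lambda>x. ennreal (l / 2 * exp (- l * \<bar>x\<bar>)))"
    using assms unfolding two_sided_exponential_rv_def by auto
  have nn: "0 \<le> l / 2 * exp (- l * \<bar>x\<bar>)" for x using l by simp
  have "renyi_entropy \<alpha> M X = 1 / (1 - \<alpha>) * ((\<alpha> - 1) * ln (l / 2) - ln \<alpha>)"
    using renyi_entropy_real_density[OF D nn, of \<alpha>] exponential_moments(1)[OF l assms(2)] l assms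
    by (simp add: ln_powr ln_div)
  also have "\<dots> = - ln (l / 2) + ln \<alpha> / (\<alpha> - 1)" using assms by (simp add: divide_simps) (simp add: algebra_simps)
  finally have h: "renyi_entropy \<alpha> M X = - ln (l / 2) + ln \<alpha> / (\<alpha> - 1)" .
  have v: "prob_space.variance M X = 2 / l^2"
    using symmetric_rv_variance[OF prob X sym D nn] exponential_moments(2)[OF l assms(2)] by simp
  have "ln (2 / l^2) + ln 2 = ln (2 / l^2 * 2)" using l by (simp only: ln_mult) simp
  also have "2 / l^2 * 2 = (2 / l)^2" using l by (simp add: power2_eq_square)
  also have "ln ((2 / l)^2) = 2 * ln (2 / l)" using l by (subst ln_realpow) auto
  also have "\<dots> = - 2 * ln (l / 2)" using l by (simp add: ln_div)
  finally have "1/2 * ln (2 / l^2) + 1/2 * ln 2 = - ln (l / 2)" by simp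
  then show ?thesis unfolding h v by simp
qed

text \<open>Symmetry of the law makes the given density even only almost everywhere. The minimum of
  g x and g (- x) is even everywhere, agrees with g almost everywhere, and is log-concave as a
  minimum of log-concave functions.\<close>

lemma even_density_exists:
  assumes "log_concave_rv M X"
  obtains F where "even_log_concave F" "distributed M lborel X (\<lambda>x. ennreal (F x))"
proof -
  interpret prob_space M by (rule prob)
  obtain V where V: "\<And>x. V x \<noteq> -\<infinity>" "convex_ereal V" and D: "distributed M lborel X (\<lambda>x. exp_neg_ereal (V x))"
    using assms unfolding log_concave_rv_def by blast
  define f where "f x = exp_neg_ereal (V x)" for x
  define g where "g x = enn2real (f x)" for x
  define F where "F x = min (g x) (g (- x))" for x
  have f_measurable [measurable]: "f \<in> borel_measurable borel"
    using distributed_borel_measurable[OF D] by (simp add: f_def[abs_def])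
  have fg: "f x = ennreal (g x)" for x by (simp add: g_def f_def exp_neg_ereal_def)
  have g_nonneg: "0 \<le> g x" for x by (simp add: g_def)
  have g_log_concave: "g x powr u * g y powr v \<le> g (u * x + v * y)"
    if uv: "0 \<le> u" "0 \<le> v" "u + v = 1" and pos: "0 < g x" "0 < g y" for x y u v
  proof -
    have ex: "\<exists>a. V x = ereal a \<and> g x = exp (- a)" if "0 < g x" for x
      using that V(1)[of x] by (cases "V x") (auto simp: g_def f_def exp_neg_ereal_def)
    obtain a b where a: "V x = ereal a" "g x = exp (- a)" and b: "V y = ereal b" "g y = exp (- b)"
      using ex pos by meson
    have le: "V (u * x + v * y) \<le> ereal (u * a + v * b)"
    proof -
      have "V (u * x + v * y) \<le> ereal u * V x + ereal v * V y"
        using V(2) uv unfolding convex_ereal_def by blast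
      then show ?thesis by (simp add: a b)
    qed
    then obtain c where c: "V (u * x + v * y) = ereal c" "c \<le> u * a + v * b"
      using V(1)[of "u * x + v * y"] by (cases "V (u * x + v * y)") auto
    have "g x powr u * g y powr v = exp (- (u * a + v * b))"
      by (simp add: a b exp_powr_real mult.commute flip: exp_add)
    also have "\<dots> \<le> exp (- c)" using c by simp
    also have "\<dots> = g (u * x + v * y)" by (simp add: g_def f_def exp_neg_ereal_def c)
    finally show ?thesis .
  qed
  \<comment> \<open>The density of - X, from the affine transformation rule with shift 0 and factor
    -1.\<close>
  have "distributed M lborel (\<lambda>x. 0 + (- 1) * X x) (\<lambda>x. f ((x - 0) / - 1) / ennreal \<bar>- 1\<bar>)"
    using D by (intro distributed_affine) (auto simp: f_def[abs_def])
  then have "density lborel (\<lambda>x. f (- x)) = distr M lborel (\<lambda>\<omega>. - X \<omega>)"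
    by (simp add: distributed_def divide_ennreal_def)
  also have "\<dots> = distr M lborel X" using sym by (simp add: symmetric_rv_def)
  also have "\<dots> = density lborel f" using distributed_distr_eq_density[OF D] by (simp add: f_def[abs_def])
  finally have "AE x in lborel. f (- x) = f x"
    by (subst (asm) sigma_finite_measure.density_unique_iff[OF sigma_finite_lborel]) auto
  then have F_AE: "AE x in lborel. f x = ennreal (F x)"
    by eventually_elim (simp add: F_def fg g_nonneg)
  have g_measurable [measurable]: "g \<in> borel_measurable borel" unfolding g_def[abs_def] by measurable
  have F_measurable [measurable]: "F \<in> borel_measurable borel" unfolding F_def[abs_def] by measurable
  have D_F: "distributed M lborel X (\<lambda>x. ennreal (F x))"
  proof -
    have "density lborel f = density lborel (\<lambda>x. ennreal (F x))"
      using F_AE by (intro density_cong) auto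
    then show ?thesis using D by (simp add: distributed_def f_def[abs_def])
  qed
  have "even_log_concave F"
  proof
    show "0 \<le> F y" for y using g_nonneg by (simp add: F_def)
    show "F (- y) = F y" for y by (simp add: F_def min.commute)
    show "(\<integral>\<^sup>+y. ennreal (F y) \<partial>lborel) = 1"
      using distributed_nn_integral[OF D_F, of "\<lambda>_. 1"] by (simp add: emeasure_space_1)
    show "F x powr u * F y powr v \<le> F (u * x + v * y)"
      if uv: "0 \<le> u" "0 \<le> v" "u + v = 1" and pos: "0 < F x" "0 < F y" for x y u v
    proof -
      have g: "0 < g x" "0 < g (- x)" "0 < g y" "0 < g (- y)" using pos by (auto simp: F_def)
      have "F x powr u * F y powr v \<le> g x powr u * g y powr v"
        using pos uv by (intro mult_mono powr_mono2) (auto simp: F_def)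
      also have "\<dots> \<le> g (u * x + v * y)" using uv g by (intro g_log_concave)
      finally have 1: "F x powr u * F y powr v \<le> g (u * x + v * y)" .
      have "F x powr u * F y powr v \<le> g (- x) powr u * g (- y) powr v"
        using pos uv by (intro mult_mono powr_mono2) (auto simp: F_def)
      also have "\<dots> \<le> g (u * (- x) + v * (- y))" using uv g by (intro g_log_concave)
      finally have "F x powr u * F y powr v \<le> g (- (u * x + v * y))" by simp
      with 1 show ?thesis by (simp add: F_def)
    qed
  qed measurable
  then show thesis using D_F by (rule that)
qed

end

theorem theorem1:
  fixes M :: "'a measure" and X :: "'a \<Rightarrow> real" and \<alpha> :: real
  assumes "prob_space M"
    and "X \<in> borel_measurable M"
    and "symmetric_rv M X"
    and "log_concave_rv M X"
    and "\<alpha> > 0" and "\<alpha> \<noteq> 1"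
  shows "(\<exists>!a. is_critical_order a) \<and>
    \<bar>alpha_star - 1.241\<bar> < 0.0005 \<and>
    (let h = renyi_entropy \<alpha> M X;
         v = prob_space.variance M X;
         b_unif = 1/2 * ln v + 1/2 * ln 12;
         b_exp = 1/2 * ln v + 1/2 * ln 2 + ln \<alpha> / (\<alpha> - 1)
     in (\<alpha> \<le> alpha_star \<longrightarrow> h \<ge> b_unif) \<and>
        (\<alpha> \<ge> alpha_star \<longrightarrow> h \<ge> b_exp) \<and>
        (\<alpha> < alpha_star \<longrightarrow> (h = b_unif \<longleftrightarrow> uniform_symmetric_rv M X)) \<and>
        (\<alpha> > alpha_star \<longrightarrow> (h = b_exp \<longleftrightarrow> two_sided_exponential_rv M X)) \<and>
        (\<alpha> = alpha_star \<longrightarrow>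
           (h = b_unif \<longleftrightarrow> uniform_symmetric_rv M X \<or> two_sided_exponential_rv M X) \<and>
           (h = b_exp \<longleftrightarrow> uniform_symmetric_rv M X \<or> two_sided_exponential_rv M X)))"
proof -
  note X = assms(1-3)
  let ?p = alpha_star
  obtain F where F: "even_log_concave F" and D: "distributed M lborel X (\<lambda>x. ennreal (F x))"
    using even_density_exists[OF X assms(4)] by blast
  interpret even_log_concave F by fact
  define v where "v = prob_space.variance M X"
  have renyi: "renyi_entropy a M X = entropy a" for a
    using renyi_entropy_real_density[OF D F_nonneg] by (simp add: entropy_def power_integral_def)
  have v: "v = second_moment"
    using symmetric_rv_variance[OF X D F_nonneg] by (simp add: v_def second_moment_def)
  have p: "1.2405 < ?p" "?p < 1.2415" by (rule alpha_star_bounds)+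
  have "1 / (?p - 1) * ln ?p = 1/2 * ln 6"
    using critical_alpha_star by (simp add: is_critical_order_def)
  then have crit: "ln ?p / (?p - 1) = ln 6 / 2" by simp
  then have crit': "(?p - 1) / 2 * ln 6 = ln ?p" using p by (simp add: field_simps)
  have near_critical: "near_critical ?p" using p by unfold_locales auto
  have ln12: "ln (12::real) = ln 2 + ln 6" using ln_mult[of 2 "6::real"] by simp
  define U E where "U \<longleftrightarrow> uniform_symmetric_rv M X" and "E \<longleftrightarrow> two_sided_exponential_rv M X"
  have uniform: "entropy a = 1/2 * ln v + 1/2 * ln 12" if U "0 < a" "a \<noteq> 1" for a
    using renyi_entropy_uniform[OF X, of a] that by (simp add: U_def renyi v_def)
  have exponential: "entropy a = 1/2 * ln v + 1/2 * ln 2 + ln a / (a - 1)" if E "0 < a" "a \<noteq> 1" for a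
    using renyi_entropy_exponential[OF X, of a] that by (simp add: E_def renyi v_def)
  have AE_dist: "distributed M lborel X (\<lambda>x. ennreal (f x))"
    if "AE x in lborel. F x = f x" and [measurable]: "f \<in> borel_measurable borel" for f
  proof -
    have "density lborel (\<lambda>x. ennreal (F x)) = density lborel (\<lambda>x. ennreal (f x))"
      using that(1) by (intro density_cong) auto
    then show ?thesis using D by (simp add: distributed_def)
  qed
  have extremal: "U \<or> E" if "entropy ?p = 1/2 * ln v + 1/2 * ln 12"
  proof -
    have "profile_mean ?p = profile_mean 1 \<or> ?p * profile_mean ?p = profile_mean 1"
      using critical_entropy_bound(2)[OF near_critical crit'] that by (simp add: v)
    then show ?thesis
    proof
      assume "profile_mean ?p = profile_mean 1"
      then obtain L where "0 < L" "AE y in lborel. F y = indicator {- L..L} y / (2 * L)"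
        using uniform_of_profile_mean_eq[of ?p] p by auto
      then have U using AE_dist uniform_symmetric_rv_iff[OF assms(2)] by (auto simp: U_def)
      then show ?thesis ..
    next
      assume "?p * profile_mean ?p = profile_mean 1"
      then obtain l where "0 < l" "AE y in lborel. F y = l / 2 * exp (- l * \<bar>y\<bar>)"
        using exponential_of_profile_mean_eq[of ?p] p by auto
      then have E using AE_dist by (auto simp: E_def two_sided_exponential_rv_def)
      then show ?thesis ..
    qed
  qed
  have base: "1/2 * ln v + 1/2 * ln 12 \<le> entropy ?p"
    using critical_entropy_bound(1)[OF near_critical crit'] by (simp add: v)
  have left: "entropy ?p \<le> entropy \<alpha>" "ln 6 / 2 < ln \<alpha> / (\<alpha> - 1)" if "\<alpha> < ?p"
    using entropy_antimono[OF assms(5) that assms(6)] ln_quotient_strict_antimono[OF assms(5) that assms(6)] p crit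
    by auto
  have right: "entropy ?p - ln 6 / 2 \<le> entropy \<alpha> - ln \<alpha> / (\<alpha> - 1)" "ln \<alpha> / (\<alpha> - 1) < ln 6 / 2" if "?p < \<alpha>"
    using shifted_entropy_mono[of ?p \<alpha>] ln_quotient_strict_antimono[of ?p \<alpha>] that p crit assms by auto
  have A1: "1/2 * ln v + 1/2 * ln 12 \<le> entropy \<alpha>" if "\<alpha> \<le> ?p"
    using that base left(1) by (cases "\<alpha> = ?p") auto
  have A2: "1/2 * ln v + 1/2 * ln 2 + ln \<alpha> / (\<alpha> - 1) \<le> entropy \<alpha>" if "?p \<le> \<alpha>"
  proof (cases "\<alpha> = ?p")
    case True
    have "ln \<alpha> / (\<alpha> - 1) = ln 6 / 2" unfolding True by (rule crit)
    moreover have "entropy \<alpha> = entropy ?p" using True by simp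
    ultimately show ?thesis using base ln12 by linarith
  next
    case False
    then have "?p < \<alpha>" using that by simp
    from right(1)[OF this] show ?thesis using base ln12 by linarith
  qed
  have A3: "entropy \<alpha> = 1/2 * ln v + 1/2 * ln 12 \<longleftrightarrow> U" if "\<alpha> < ?p"
  proof
    assume eq: "entropy \<alpha> = 1/2 * ln v + 1/2 * ln 12"
    \<comment> \<open>Equality at \<alpha> squeezes \<open>entropy ?p\<close>, which is at most
      \<open>entropy \<alpha>\<close>, onto its lower bound. The law E is then excluded because its
      entropy at \<alpha> lies strictly above the uniform bound.\<close>
    then have "U \<or> E" using left(1)[OF that] base by (intro extremal) simp
    moreover have "\<not> E"
    proof
      assume E
      from exponential[OF this assms(5,6)] show False using eq left(2)[OF that] ln12 by linarith
    qed
    ultimately show U by blast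
  qed (use uniform assms in auto)
  have A4: "entropy \<alpha> = 1/2 * ln v + 1/2 * ln 2 + ln \<alpha> / (\<alpha> - 1) \<longleftrightarrow> E" if "?p < \<alpha>"
  proof
    assume eq: "entropy \<alpha> = 1/2 * ln v + 1/2 * ln 2 + ln \<alpha> / (\<alpha> - 1)"
    \<comment> \<open>The same squeeze for the shifted entropies: ln 12 = ln 2 + ln 6 turns the
      shift ln 6 / 2 at \<open>?p\<close> into the difference of the constants in the two
      bounds.\<close>
    have "U \<or> E" by (rule extremal) (use eq right(1)[OF that] base ln12 in linarith)
    moreover have "\<not> U"
    proof
      assume U
      from uniform[OF this assms(5,6)] show False using eq right(2)[OF that] ln12 by linarith
    qed
    ultimately show E by blast
  qed (use exponential assms in auto)
  have A5: "entropy \<alpha> = 1/2 * ln v + 1/2 * ln 12 \<longleftrightarrow> U \<or> E"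
    and A6: "1/2 * ln v + 1/2 * ln 2 + ln \<alpha> / (\<alpha> - 1) = 1/2 * ln v + 1/2 * ln 12" if "\<alpha> = ?p"
  proof -
    show b: "1/2 * ln v + 1/2 * ln 2 + ln \<alpha> / (\<alpha> - 1) = 1/2 * ln v + 1/2 * ln 12"
      using that crit ln12 by simp
    show "entropy \<alpha> = 1/2 * ln v + 1/2 * ln 12 \<longleftrightarrow> U \<or> E"
      using extremal uniform[of \<alpha>] exponential[of \<alpha>] that assms b by auto
  qed
  have "?p - 1.241 < 0.0005" "- (?p - 1.241) < 0.0005" using p by simp_all
  then have num: "\<bar>?p - 1.241\<bar> < 0.0005" by (simp only: abs_less_iff)
  show ?thesis
    unfolding Let_def renyi v_def[symmetric] U_def[symmetric] E_def[symmetric]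
    using ex1_critical_order num A1 A2 A3 A4 A5 A6 by auto
qed

end
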